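(* Let $\alpha\ge2$, $c\ge0$, $0<\lambda<\infty$, let $F:[0,\infty)\to[0,1]$ be measurable, and put $\lambda(x)=\lambda F(\|x\|)$ for $x\in\mathbb{R}^2$. Let $G\subseteq\mathbb{R}^2$ be an open set on which $\lambda(x)$ is subharmonic, and let $y_0\in G$. Let $\bar r(y_0)=\sup\{t>0: b(y_0,t)\subseteq G\}\in(0,\infty]$, where $b(y_0,t)$ is the closed disc of radius $t$ centered at $y_0$. Let $\mathsf I(y_0)$ be the interference at $y_0$ generated by the Poisson point process with intensity function $\lambda(x)$. Then for every $z>0$ $$\mathbb{P}(\mathsf I(y_0)\ge z)\ \ge\ 1-\exp\left(-2\pi\lambda F(\|y_0\|)\int_0^{\bar r(y_0)}r\,\mathbb{P}\big(\mathsf g\ge z(c+r^\alpha)\big)\,\mathrm dr\right),$$ where $\mathsf g$ denotes a generic fading coefficient.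
   Context: Setting: $\Phi$ is a Poisson point process on $\mathbb{R}^2$ with intensity function $\lambda(x)=\lambda F(\|x\|)$. The points of $\Phi$ carry i.i.d. non-negative random marks $\mathsf g_{\mathsf x}$ (fading coefficients, arbitrary distribution), independent of $\Phi$, with $\mathbb{E}[\mathsf g_{\mathsf x}]=1$; $\mathsf g$ has the common distribution of the marks. The path loss function is $\ell(r)=(c+r^{\alpha})^{-1}$, and $\mathsf I(y_0)=\sum_{\mathsf x\in\Phi}\mathsf g_{\mathsf x}\,\ell(\|\mathsf x-y_0\|)$. A function $h$ that is twice continuously differentiable on an open set $G\subseteq\mathbb{R}^n$ is called subharmonic on $G$ if $\sum_{k=1}^n\frac{\partial^2}{\partial x_k^2}h(x)\ge0$ on $G$. *)

theory Defs
  imports "HOL-Probability.Probability"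
begin

definition partial_deriv :: "'n \<Rightarrow> (real ^ 'n \<Rightarrow> real) \<Rightarrow> real ^ 'n \<Rightarrow> real" where
  "partial_deriv k h x = deriv (\<lambda>t. h (x + t *\<^sub>R axis k 1)) 0"

definition C2_on :: "'a::real_normed_vector set \<Rightarrow> ('a \<Rightarrow> real) \<Rightarrow> bool" where
  "C2_on G h \<longleftrightarrow>
     (\<exists>(h' :: 'a \<Rightarrow> 'a \<Rightarrow>\<^sub>L real) (h'' :: 'a \<Rightarrow> 'a \<Rightarrow>\<^sub>L 'a \<Rightarrow>\<^sub>L real).
        (\<forall>x\<in>G. (h has_derivative blinfun_apply (h' x)) (at x)) \<and>
        (\<forall>x\<in>G. (h' has_derivative blinfun_apply (h'' x)) (at x)) \<and>
        continuous_on G h'')"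

definition subharmonic_on :: "(real ^ 'n) set \<Rightarrow> (real ^ 'n \<Rightarrow> real) \<Rightarrow> bool" where
  "subharmonic_on G h \<longleftrightarrow>
     open G \<and> C2_on G h \<and>
     (\<forall>x\<in>G. 0 \<le> (\<Sum>k\<in>UNIV. partial_deriv k (partial_deriv k h) x))"

text \<open>A (simple, locally finite) Poisson point process is a random set of points. Local
  integrability of the intensity makes the Bochner integral below the genuine intensity
  measure; the explicit Poisson weights also cover sets of intensity measure zero.\<close>

definition poisson_point_process ::
    "'w measure \<Rightarrow> ('a::euclidean_space \<Rightarrow> real) \<Rightarrow> ('w \<Rightarrow> 'a set) \<Rightarrow> bool" where
  "poisson_point_process M intens \<Phi> \<longleftrightarrow>
     (\<forall>x. 0 \<le> intens x) \<and>
     (\<forall>B\<in>sets borel. bounded B \<longrightarrow> set_integrable lborel B intens) \<and>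
     (\<forall>\<omega>\<in>space M. \<forall>B. bounded B \<longrightarrow> finite (\<Phi> \<omega> \<inter> B)) \<and>
     (\<forall>B\<in>sets borel. bounded B \<longrightarrow>
        (\<lambda>\<omega>. card (\<Phi> \<omega> \<inter> B)) \<in> measurable M (count_space UNIV) \<and>
        (\<forall>k. measure M {\<omega>\<in>space M. card (\<Phi> \<omega> \<inter> B) = k} =
           (LINT x:B|lborel. intens x) ^ k / fact k * exp (- (LINT x:B|lborel. intens x)))) \<and>
     (\<forall>(I :: nat set) B. finite I \<longrightarrow> disjoint_family_on B I \<longrightarrow>
        (\<forall>i\<in>I. B i \<in> sets borel \<and> bounded (B i)) \<longrightarrow>
        prob_space.indep_vars M (\<lambda>_. count_space UNIV) (\<lambda>i \<omega>. card (\<Phi> \<omega> \<inter> B i)) I)"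

text \<open>The mark of a point \<open>x\<close> of \<open>\<Phi> \<omega>\<close> is \<open>mark \<omega> x\<close>; values off \<open>\<Phi> \<omega>\<close> are irrelevant.
  The points are enumerated measurably and without repetition as \<open>X 0, X 1, \<dots>\<close>, with total
  number \<open>N\<close> (possibly infinite), and the \<open>n\<close>-th point carries the \<open>n\<close>-th term of an i.i.d.
  sequence \<open>m\<close> with the law of \<open>g\<close>. Independence is required of the whole enumeration, not only
  of the set \<open>\<Phi> \<omega>\<close>: otherwise the order of enumeration could depend on the marks.\<close>

definition iid_marks ::
    "'w measure \<Rightarrow> ('w \<Rightarrow> 'a::euclidean_space set) \<Rightarrow> ('w \<Rightarrow> 'a \<Rightarrow> real) \<Rightarrow> ('w \<Rightarrow> real) \<Rightarrow> bool" where
  "iid_marks M \<Phi> mark g \<longleftrightarrow>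
     (\<exists>(N :: 'w \<Rightarrow> enat) (X :: nat \<Rightarrow> 'w \<Rightarrow> 'a) (m :: nat \<Rightarrow> 'w \<Rightarrow> real).
        N \<in> measurable M (count_space UNIV) \<and>
        (\<forall>n. X n \<in> borel_measurable M) \<and>
        (\<forall>\<omega>\<in>space M. bij_betw (\<lambda>n. X n \<omega>) {n. enat n < N \<omega>} (\<Phi> \<omega>)) \<and>
        (\<forall>\<omega>\<in>space M. \<forall>n. enat n < N \<omega> \<longrightarrow> mark \<omega> (X n \<omega>) = m n \<omega>) \<and>
        prob_space.indep_vars M (\<lambda>_. borel) m UNIV \<and>
        (\<forall>n. distr M borel (m n) = distr M borel g) \<and>
        prob_space.indep_set M
          (sets (vimage_algebra (space M) (\<lambda>\<omega>. (N \<omega>, \<lambda>n. X n \<omega>))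
             (count_space UNIV \<Otimes>\<^sub>M (\<Pi>\<^sub>M n\<in>UNIV. borel))))
          (sets (vimage_algebra (space M) (\<lambda>\<omega> n. m n \<omega>) (\<Pi>\<^sub>M n\<in>UNIV. borel))))"

text \<open>Values in \<open>[0, \<infinity>]\<close>: for \<open>c = 0\<close> the path loss is infinite at distance \<open>0\<close>, and the
  interference series may diverge.\<close>

definition path_loss :: "real \<Rightarrow> real \<Rightarrow> real \<Rightarrow> ennreal" where
  "path_loss c \<alpha> r = inverse (ennreal (c + r powr \<alpha>))"

definition interference ::
    "real \<Rightarrow> real \<Rightarrow> 'a::euclidean_space set \<Rightarrow> ('a \<Rightarrow> real) \<Rightarrow> 'a \<Rightarrow> ennreal" where
  "interference c \<alpha> P mark y =
     (\<Sum>\<^sub>\<infinity>x\<in>P. ennreal (mark x) * path_loss c \<alpha> (norm (x - y)))"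

definition disc_radius :: "'a::metric_space set \<Rightarrow> 'a \<Rightarrow> ereal" where
  "disc_radius G y = Sup (ereal ` {t. 0 < t \<and> cball y t \<subseteq> G})"

end

theory Submission
  imports Defs
begin

text \<open>The interference exceeds \<open>z\<close> as soon as a single marked point contributes at least \<open>z\<close>. Cut a disc
  \<open>b(y\<^sub>0, R) \<subseteq> G\<close> into \<open>n\<close> annuli with equally spaced squared radii \<open>r\<^sub>i\<^sup>2 = i R\<^sup>2 / n\<close> and let
  \<open>h(r) = P(g \<ge> z (c + r\<^sup>\<alpha>))\<close>. Averaging first over the marks and then over the independent Poisson
  counts, the probability that no point of an annulus has a mark above the threshold at its outer radius
  is \<open>exp(- \<Sum>\<^sub>i h(r\<^sub>i) \<Lambda>(A\<^sub>i))\<close>. As \<open>h\<close> decreases, summation by parts leaves only the intensities of full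
  discs, which the sub-mean value property bounds below by \<open>\<pi> r\<^sub>i\<^sup>2 \<lambda>(y\<^sub>0)\<close>. Then \<open>n \<rightarrow> \<infinity>\<close> and \<open>R \<rightarrow> r(y\<^sub>0)\<close>.

  The sub-mean value property over balls needs no polar coordinates: \<open>u(x) - u(0)\<close> is the integral of
  \<open>\<nabla>u(s x) \<bullet> x\<close> over \<open>s \<in> [0, 1]\<close>, and with \<open>w(x) = (\<parallel>x\<parallel>\<^sup>2 - R\<^sup>2)/2\<close>, so that \<open>\<nabla>w(x) = x\<close>, partial integration
  turns \<open>\<integral> \<nabla>u(s x) \<bullet> x dx\<close> into \<open>- \<integral> w(x) s \<Delta>u(s x) dx \<ge> 0\<close>.\<close>

subsection \<open>Sub-mean value property over balls\<close>

text \<open>The squared norm along a line is a quadratic in \<open>s\<close> with leading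
  coefficient \<open>e \<bullet> e\<close>, so there are at most two solutions, with sum
  \<open>d\<close>. These are the parameters at which the cut-off function \<open>q\<close> below
  may fail to be differentiable along the line.\<close>

lemma finite_line_sphere:
  fixes x e :: "'a::real_inner"
  assumes "e \<noteq> 0"
  shows "finite {s. norm (x + s *\<^sub>R e) = R}"
proof (cases "{s. norm (x + s *\<^sub>R e) = R} = {}")
  case False
  then obtain s where s: "norm (x + s *\<^sub>R e) = R" by auto
  define d where "d = - 2 * (x \<bullet> e) / (e \<bullet> e)"
  have ee: "e \<bullet> e \<noteq> 0" using assms by simp
  have "t = s \<or> t = d - s" if t: "norm (x + t *\<^sub>R e) = R" for t
  proof -
    have "(x + s *\<^sub>R e) \<bullet> (x + s *\<^sub>R e) = (x + t *\<^sub>R e) \<bullet> (x + t *\<^sub>R e)"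
      using s t by (metis dot_square_norm)
    then have "(t - s) * (2 * (x \<bullet> e) + (s + t) * (e \<bullet> e)) = 0"
      by (simp add: inner_simps inner_commute algebra_simps)
    then have "t = s \<or> (s + t) * (e \<bullet> e) = - 2 * (x \<bullet> e)" by auto
    then show ?thesis using ee by (auto simp: d_def field_simps)
  qed
  then have "{s. norm (x + s *\<^sub>R e) = R} \<subseteq> {s, d - s}" by auto
  then show ?thesis using finite_subset by blast
qed simp

lemma has_derivative_imp_has_field_derivative_line:
  fixes v :: "'a::real_normed_vector \<Rightarrow> real"
  assumes "(v has_derivative D) (at (x + s *\<^sub>R e))"
  shows "((\<lambda>t. v (x + t *\<^sub>R e)) has_field_derivative D e) (at s)"
proof -
  have "((\<lambda>t. x + t *\<^sub>R e) has_derivative (\<lambda>t. t *\<^sub>R e)) (at s)"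
    by (auto intro!: derivative_eq_intros)
  from has_derivative_compose[OF this assms]
  have "((\<lambda>t. v (x + t *\<^sub>R e)) has_derivative (\<lambda>t. D (t *\<^sub>R e))) (at s)" .
  moreover have "(\<lambda>t. D (t *\<^sub>R e)) = (*) (D e)"
    using has_derivative_bounded_linear[OF assms]
    by (auto simp: linear_cmul bounded_linear.linear)
  ultimately show ?thesis by (simp add: has_field_derivative_def)
qed

lemma lborel_integral_translate:
  fixes f :: "'a::euclidean_space \<Rightarrow> real"
  assumes "integrable lborel f"
  shows "integrable lborel (\<lambda>x. f (x + c))" "(LINT x|lborel. f (x + c)) = (LINT x|lborel. f x)"
proof -
  have eq: "distr lborel borel (\<lambda>x. x + c) = (lborel :: 'a measure)"
    unfolding add.commute[of _ c] by (rule lborel_distr_plus)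
  have [measurable]: "f \<in> borel_measurable borel" using assms by auto
  have "integrable (distr lborel borel (\<lambda>x. x + c)) f" using assms by (simp only: eq)
  then show "integrable lborel (\<lambda>x. f (x + c))"
    by (subst (asm) integrable_distr_eq) auto
  have "(LINT x|lborel. f x) = (LINT x|distr lborel borel (\<lambda>x. x + c). f x)" by (simp only: eq)
  also have "\<dots> = (LINT x|lborel. f (x + c))" by (subst integral_distr) auto
  finally show "(LINT x|lborel. f (x + c)) = (LINT x|lborel. f x)" by simp
qed

text \<open>Averages \<open>q (x + e) - q x = \<integral>\<^sub>0\<^sup>1 q' (x + s e) ds\<close> over \<open>x\<close>; the left side averages to zero by
  translation invariance.\<close>

lemma lborel_integral_directional_derivative_eq_0:
  fixes q q' :: "'a::euclidean_space \<Rightarrow> real"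
  assumes q: "integrable lborel q" and q': "integrable lborel q'"
    and ftc: "\<And>x. ((\<lambda>s. q' (x + s *\<^sub>R e)) has_integral q (x + e) - q x) {0..1}"
  shows "(LINT x|lborel. q' x) = 0"
proof -
  define f :: "real \<times> 'a \<Rightarrow> real" where
    "f = (\<lambda>(s, x). indicator {0..1} s * q' (x + s *\<^sub>R e))"
  have [measurable]: "q' \<in> borel_measurable borel" using q' by auto
  have fm: "f \<in> borel_measurable (lborel \<Otimes>\<^sub>M lborel)"
    unfolding f_def by measurable
  have int_x: "integrable lborel (\<lambda>x. f (s, x))" for s
    unfolding f_def by (simp add: lborel_integral_translate(1)[OF q'])
  have f: "integrable (lborel \<Otimes>\<^sub>M lborel) f"
  proof (rule lborel_pair.Fubini_integrable[OF fm])
    \<comment> \<open>By translation invariance the inner integral is the same for every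
      \<open>s\<close> in \<open>{0..1}\<close>, so the Fubini criterion reduces to integrability of
      an indicator.\<close>
    have "(LINT x|lborel. norm (f (s, x))) = indicator {0..1} s * (LINT x|lborel. \<bar>q' x\<bar>)" for s
      using lborel_integral_translate(2)[OF integrable_abs[OF q'], of "s *\<^sub>R e"]
      by (simp add: f_def abs_mult)
    then show "integrable lborel (\<lambda>s. LINT x|lborel. norm (f (s, x)))" by simp
  qed (use int_x in simp)
  have "(LINT x|lborel. LINT s|lborel. f (s, x)) = (LINT s|lborel. LINT x|lborel. f (s, x))"
    using lborel_pair.Fubini_integral[of "\<lambda>s x. f (s, x)"] f by simp
  also have "\<dots> = (LINT s::real|lborel. indicator {0..1} s * (LINT x|lborel. q' x))"
    by (simp add: f_def lborel_integral_translate(2)[OF q'])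
  also have "\<dots> = (LINT x|lborel. q' x)" by simp
  finally have 1: "(LINT x|lborel. LINT s|lborel. f (s, x)) = (LINT x|lborel. q' x)" .
  \<comment> \<open>Fubini yields Lebesgue integrable slices only for almost every \<open>x\<close>;
    for those the gauge integral in \<open>ftc\<close> agrees with the Lebesgue integral.\<close>
  have "AE x in lborel. integrable lborel (\<lambda>s. f (s, x))"
    using lborel_pair.AE_integrable_snd[of "\<lambda>s x. f (s, x)"] f by simp
  then have "AE x in lborel. (LINT s|lborel. f (s, x)) = q (x + e) - q x"
  proof eventually_elim
    case (elim x)
    then have "set_integrable lborel {0..1} (\<lambda>s. q' (x + s *\<^sub>R e))"
      by (simp add: f_def set_integrable_def)
    from set_borel_integral_eq_integral(2)[OF this] show ?case
      using integral_unique[OF ftc] by (simp add: f_def set_lebesgue_integral_def)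
  qed
  then have "(LINT x|lborel. LINT s|lborel. f (s, x)) = (LINT x|lborel. q (x + e) - q x)"
  proof (intro integral_cong_AE)
    show "(\<lambda>x. LINT s|lborel. f (s, x)) \<in> borel_measurable lborel"
      using lborel_pair.integrable_snd[of "\<lambda>s x. f (s, x)"] f by auto
  qed (use q in \<open>auto intro: lborel_integral_translate\<close>)
  also have "\<dots> = 0"
    using lborel_integral_translate[OF q, of e] q by simp
  finally show ?thesis using 1 by simp
qed

text \<open>The weight \<open>(\<parallel>x\<parallel>\<^sup>2 - R\<^sup>2)/2\<close> vanishes on the sphere, so its product with \<open>v\<close> extends by zero to a
  continuous function that is differentiable off finitely many points of every line.\<close>

lemma lborel_integral_cball_weight_derivative_eq_0:
  fixes v :: "'a::euclidean_space \<Rightarrow> real"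
  assumes "e \<noteq> 0"
    and v: "\<And>x. x \<in> cball 0 R \<Longrightarrow> (v has_derivative v' x) (at x)"
    and v': "continuous_on (cball 0 R) (\<lambda>x. v' x e)"
  shows "(LINT x:cball 0 R|lborel. (x \<bullet> e) * v x + ((norm x)\<^sup>2 - R\<^sup>2) / 2 * v' x e) = 0"
proof (cases "R < 0")
  case False
  define w where "w = (\<lambda>x::'a. ((norm x)\<^sup>2 - R\<^sup>2) / 2)"
  define q where "q = (\<lambda>x. if x \<in> cball 0 R then w x * v x else 0)"
  define q' where "q' = (\<lambda>x. indicator (cball 0 R) x * ((x \<bullet> e) * v x + w x * v' x e))"
  have cv: "continuous_on (cball 0 R) v"
    using v by (meson continuous_at_imp_continuous_on has_derivative_continuous)
  have cw: "continuous_on A w" for A unfolding w_def by (intro continuous_intros) auto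
  have "integrable lborel (\<lambda>x. indicator (cball 0 R) x *\<^sub>R (w x * v x))"
    by (intro borel_integrable_compact continuous_intros cw cv) simp
  then have q: "integrable lborel q"
    by (rule Bochner_Integration.integrable_cong[THEN iffD1, rotated -1]) (auto simp: q_def)
  have "integrable lborel (\<lambda>x. indicator (cball 0 R) x *\<^sub>R ((x \<bullet> e) * v x + w x * v' x e))"
    by (intro borel_integrable_compact continuous_intros cw cv v') simp
  then have q': "integrable lborel q'" by (simp add: q'_def)
  \<comment> \<open>The closed ball and the complement of the open ball are closed sets that meet in
    the sphere, where \<open>w\<close> vanishes, so the two branches of \<open>q\<close> glue
    continuously.\<close>
  have "continuous_on (cball 0 R \<union> (- ball 0 R)) q"
    unfolding q_def
  proof (rule continuous_on_cases)
    show "\<forall>x. x \<in> cball 0 R \<and> \<not> x \<in> cball 0 R \<or> x \<in> - ball 0 R \<and> x \<in> cball 0 R \<longrightarrow> w x * v x = 0"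
      by (auto simp: w_def dest: antisym)
  qed (auto intro!: continuous_intros cw cv)
  moreover have "cball 0 R \<union> (- ball 0 R) = (UNIV :: 'a set)" by auto
  ultimately have cq: "continuous_on UNIV q" by simp
  have "(LINT x|lborel. q' x) = 0"
  proof (rule lborel_integral_directional_derivative_eq_0[OF q q'])
    fix x
    have "((\<lambda>s. q' (x + s *\<^sub>R e)) has_integral q (x + 1 *\<^sub>R e) - q (x + 0 *\<^sub>R e)) {0..1}"
    proof (rule fundamental_theorem_of_calculus_strong)
      show "finite {s. norm (x + s *\<^sub>R e) = R}" by (rule finite_line_sphere) fact
      show "continuous_on {0..1} (\<lambda>s. q (x + s *\<^sub>R e))"
        by (intro continuous_on_compose2[OF cq] continuous_intros) auto
      fix s assume "s \<in> {0..1} - {s. norm (x + s *\<^sub>R e) = R}"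
      then consider "norm (x + s *\<^sub>R e) < R" | "norm (x + s *\<^sub>R e) > R" by fastforce
      then have "((\<lambda>s. q (x + s *\<^sub>R e)) has_field_derivative q' (x + s *\<^sub>R e)) (at s)"
      proof cases
        case 1
        define y where "y = x + s *\<^sub>R e"
        have y: "y \<in> ball 0 R" using 1 by (simp add: y_def)
        have "((\<lambda>x. ((x \<bullet> x) - R\<^sup>2) / 2) has_derivative (\<lambda>h. y \<bullet> h)) (at y)"
          by (auto intro!: derivative_eq_intros simp: inner_commute)
        then have "(w has_derivative (\<lambda>h. y \<bullet> h)) (at y)"
          by (simp add: w_def dot_square_norm)
        moreover have "(v has_derivative v' y) (at y)" using v y by auto
        ultimately have "((\<lambda>x. w x * v x) has_derivative (\<lambda>h. w y * v' y h + (y \<bullet> h) * v y)) (at y)"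
          by (rule has_derivative_mult)
        then have "(q has_derivative (\<lambda>h. w y * v' y h + (y \<bullet> h) * v y)) (at y)"
          by (rule has_derivative_transform_within_open[OF _ open_ball y]) (simp add: q_def)
        from has_derivative_imp_has_field_derivative_line[OF this[unfolded y_def]]
        show ?thesis using y by (simp add: q'_def y_def add.commute)
      next
        case 2
        have "((\<lambda>_::'a. 0::real) has_derivative (\<lambda>_. 0)) (at (x + s *\<^sub>R e))" by simp
        then have "(q has_derivative (\<lambda>_. 0)) (at (x + s *\<^sub>R e))"
          by (rule has_derivative_transform_within_open[where s = "- cball 0 R"])
             (use 2 in \<open>auto simp: q_def\<close>)
        from has_derivative_imp_has_field_derivative_line[OF this]
        show ?thesis using 2 by (simp add: q'_def)
      qed
      then show "((\<lambda>s. q (x + s *\<^sub>R e)) has_vector_derivative q' (x + s *\<^sub>R e)) (at s)"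
        by (simp add: has_real_derivative_iff_has_vector_derivative)
    qed simp
    then show "((\<lambda>s. q' (x + s *\<^sub>R e)) has_integral q (x + e) - q x) {0..1}" by simp
  qed
  then show ?thesis by (simp add: set_lebesgue_integral_def q'_def w_def)
qed (simp add: set_lebesgue_integral_def)

text \<open>For each basis vector \<open>b\<close> the weighted identity is applied to the component
  \<open>u' (s x) b\<close> in direction \<open>b\<close>. Summing over \<open>b\<close> produces
  the radial derivative and the trace of \<open>u''\<close>, which is the Laplacian; the factor
  \<open>s\<close> comes from the chain rule.\<close>

lemma radial_derivative_integral_nonneg:
  fixes u' :: "'a::euclidean_space \<Rightarrow> 'a \<Rightarrow>\<^sub>L real"
  assumes u'': "\<And>x. x \<in> cball 0 R \<Longrightarrow> (u' has_derivative blinfun_apply (u'' x)) (at x)"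
    and cont: "continuous_on (cball 0 R) u''"
    and lap: "\<And>x. x \<in> cball 0 R \<Longrightarrow> 0 \<le> (\<Sum>b\<in>Basis. blinfun_apply (blinfun_apply (u'' x) b) b)"
    and s: "s \<in> {0..1}"
  shows "0 \<le> (LINT x:cball 0 R|lborel. blinfun_apply (u' (s *\<^sub>R x)) x)"
proof -
  define w where "w = (\<lambda>x::'a. ((norm x)\<^sup>2 - R\<^sup>2) / 2)"
  define k where "k = (\<lambda>b x. (x \<bullet> b) * blinfun_apply (u' (s *\<^sub>R x)) b
      + w x * (s * blinfun_apply (blinfun_apply (u'' (s *\<^sub>R x)) b) b))"
  have sc: "s *\<^sub>R x \<in> cball 0 R" if "x \<in> cball 0 R" for x :: 'a
  proof -
    have "s * norm x \<le> 1 * norm x" using s by (intro mult_right_mono) auto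
    then show ?thesis using that s by simp
  qed
  have cu'': "continuous_on (cball 0 R) (\<lambda>x. u'' (s *\<^sub>R x))"
    by (rule continuous_on_compose2[OF cont]) (use sc in \<open>auto intro!: continuous_intros\<close>)
  have "continuous_on (cball 0 R) u'"
    by (meson u'' continuous_at_imp_continuous_on has_derivative_continuous)
  then have cu': "continuous_on (cball 0 R) (\<lambda>x. u' (s *\<^sub>R x))"
    by (rule continuous_on_compose2) (use sc in \<open>auto intro!: continuous_intros\<close>)
  have cw: "continuous_on A w" for A unfolding w_def by (intro continuous_intros) auto
  have ik: "integrable lborel (\<lambda>x. indicator (cball 0 R) x *\<^sub>R k b x)" for b
    unfolding k_def by (intro borel_integrable_compact continuous_intros cw cu' cu'') simp
  have iu': "integrable lborel (\<lambda>x. indicator (cball 0 R) x *\<^sub>R blinfun_apply (u' (s *\<^sub>R x)) x)"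
    by (intro borel_integrable_compact continuous_intros cu') simp
  have 0: "(LINT x:cball 0 R|lborel. k b x) = 0" if "b \<in> Basis" for b
    unfolding k_def w_def
  proof (rule lborel_integral_cball_weight_derivative_eq_0
      [where v' = "\<lambda>x h. s * blinfun_apply (blinfun_apply (u'' (s *\<^sub>R x)) h) b"])
    fix x :: 'a assume x: "x \<in> cball 0 R"
    have "((\<lambda>x. s *\<^sub>R x) has_derivative (\<lambda>h. s *\<^sub>R h)) (at x)"
      by (auto intro!: derivative_eq_intros)
    from has_derivative_compose[OF this u''[OF sc[OF x]]]
    have "((\<lambda>x. u' (s *\<^sub>R x)) has_derivative (\<lambda>h. blinfun_apply (u'' (s *\<^sub>R x)) (s *\<^sub>R h))) (at x)" .
    from bounded_linear.has_derivative[OF blinfun.bounded_linear_left this, of b]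
    show "((\<lambda>x. blinfun_apply (u' (s *\<^sub>R x)) b) has_derivative
        (\<lambda>h. s * blinfun_apply (blinfun_apply (u'' (s *\<^sub>R x)) h) b)) (at x)"
      by (simp add: blinfun.scaleR_right blinfun.scaleR_left)
  next
    show "continuous_on (cball 0 R) (\<lambda>x. s * blinfun_apply (blinfun_apply (u'' (s *\<^sub>R x)) b) b)"
      by (intro continuous_intros cu'')
  qed (use that in auto)
  have "0 = (\<Sum>b\<in>Basis. (LINT x|lborel. indicator (cball 0 R) x *\<^sub>R k b x))"
    using 0 by (simp add: set_lebesgue_integral_def)
  also have "\<dots> = (LINT x|lborel. (\<Sum>b\<in>Basis. indicator (cball 0 R) x *\<^sub>R k b x))"
    by (rule Bochner_Integration.integral_sum[symmetric]) (rule ik)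
  also have "\<dots> \<le> (LINT x|lborel. indicator (cball 0 R) x *\<^sub>R blinfun_apply (u' (s *\<^sub>R x)) x)"
  proof (rule integral_mono)
    fix x :: 'a
    \<comment> \<open>The sum differs from the radial derivative by \<open>w x * s\<close> times the
      Laplacian at \<open>s x\<close>, which is nonpositive because \<open>w\<close> is so on the
      ball.\<close>
    have "(\<Sum>b\<in>Basis. k b x) \<le> blinfun_apply (u' (s *\<^sub>R x)) x" if x: "x \<in> cball 0 R"
    proof -
      have "blinfun_apply (u' (s *\<^sub>R x)) x = blinfun_apply (u' (s *\<^sub>R x)) (\<Sum>b\<in>Basis. (x \<bullet> b) *\<^sub>R b)"
        by (simp add: euclidean_representation)
      also have "\<dots> = (\<Sum>b\<in>Basis. (x \<bullet> b) * blinfun_apply (u' (s *\<^sub>R x)) b)"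
        by (simp add: blinfun.sum_right blinfun.scaleR_right)
      finally have "(\<Sum>b\<in>Basis. k b x) = blinfun_apply (u' (s *\<^sub>R x)) x
          + w x * (s * (\<Sum>b\<in>Basis. blinfun_apply (blinfun_apply (u'' (s *\<^sub>R x)) b) b))"
        by (simp add: k_def sum.distrib sum_distrib_left)
      moreover have "w x \<le> 0" using x by (simp add: w_def power_mono)
      moreover have "0 \<le> s * (\<Sum>b\<in>Basis. blinfun_apply (blinfun_apply (u'' (s *\<^sub>R x)) b) b)"
        using s lap[OF sc[OF x]] by simp
      ultimately show ?thesis by (simp add: mult_nonpos_nonneg)
    qed
    then show "(\<Sum>b\<in>Basis. indicator (cball 0 R) x *\<^sub>R k b x)
        \<le> indicator (cball 0 R) x *\<^sub>R blinfun_apply (u' (s *\<^sub>R x)) x"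
      by (auto simp: indicator_def)
  qed (rule Bochner_Integration.integrable_sum, rule ik, rule iu')
  finally show ?thesis by (simp add: set_lebesgue_integral_def)
qed

text \<open>On the ball, \<open>u x - u 0\<close> is the integral of the radial derivative along the
  segment from 0 to \<open>x\<close>. Fubini exchanges the integrals, and every slice in
  \<open>s\<close> is then nonnegative.\<close>

lemma sub_mean_value_cball_0:
  fixes u :: "'a::euclidean_space \<Rightarrow> real" and u' :: "'a \<Rightarrow> 'a \<Rightarrow>\<^sub>L real"
  assumes u': "\<And>x. x \<in> cball 0 R \<Longrightarrow> (u has_derivative blinfun_apply (u' x)) (at x)"
    and u'': "\<And>x. x \<in> cball 0 R \<Longrightarrow> (u' has_derivative blinfun_apply (u'' x)) (at x)"
    and cont: "continuous_on (cball 0 R) u''"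
    and lap: "\<And>x. x \<in> cball 0 R \<Longrightarrow> 0 \<le> (\<Sum>b\<in>Basis. blinfun_apply (blinfun_apply (u'' x) b) b)"
  shows "u 0 * measure lborel (cball 0 R :: 'a set) \<le> (LINT x:cball 0 R|lborel. u x)"
proof -
  define B where "B = (cball 0 R :: 'a set)"
  define f :: "real \<times> 'a \<Rightarrow> real" where
    "f = (\<lambda>(s, x). indicator {0..1} s * (indicator B x * blinfun_apply (u' (s *\<^sub>R x)) x))"
  have sc: "s *\<^sub>R x \<in> B" if "x \<in> B" "s \<in> {0..1}" for x s
  proof -
    have "s * norm x \<le> 1 * norm x" using that by (intro mult_right_mono) auto
    then show ?thesis using that by (simp add: B_def)
  qed
  have cu: "continuous_on B u"
    unfolding B_def by (meson u' continuous_at_imp_continuous_on has_derivative_continuous)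
  have cu': "continuous_on B u'"
    unfolding B_def by (meson u'' continuous_at_imp_continuous_on has_derivative_continuous)
  have iu: "integrable lborel (\<lambda>x. indicator B x *\<^sub>R u x)"
    by (intro borel_integrable_compact cu) (simp add: B_def)
  \<comment> \<open>Continuity on the compact product gives the joint integrability that Fubini
    needs; the fact \<open>sc\<close>, star-shapedness of the ball, keeps \<open>s x\<close> where
    \<open>u'\<close> is controlled.\<close>
  have "integrable lborel (\<lambda>p. indicator ({0..1} \<times> B) p *\<^sub>R blinfun_apply (u' (fst p *\<^sub>R snd p)) (snd p))"
    by (intro borel_integrable_compact continuous_intros continuous_on_compose2[OF cu'])
       (use sc in \<open>auto intro!: compact_Times simp: B_def\<close>)
  then have f: "integrable (lborel \<Otimes>\<^sub>M lborel) f"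
    unfolding lborel_prod
    by (rule Bochner_Integration.integrable_cong[THEN iffD1, rotated -1])
       (auto simp: f_def indicator_def)
  have eq: "(LINT s|lborel. f (s, x)) = indicator B x *\<^sub>R (u x - u 0)" for x
  proof (cases "x \<in> B")
    case True
    have "(LINT s|lborel. indicator {0..1} s *\<^sub>R blinfun_apply (u' (s *\<^sub>R x)) x)
        = u (1 *\<^sub>R x) - u (0 *\<^sub>R x)"
    proof (rule integral_FTC_atLeastAtMost)
      fix s :: real assume s: "0 \<le> s" "s \<le> 1"
      have "(u has_derivative blinfun_apply (u' (0 + s *\<^sub>R x))) (at (0 + s *\<^sub>R x))"
        using u' sc[OF True, of s] s by (simp add: B_def)
      from has_derivative_imp_has_field_derivative_line[OF this]
      show "((\<lambda>s. u (s *\<^sub>R x)) has_vector_derivative blinfun_apply (u' (s *\<^sub>R x)) x) (at s within {0..1})"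
        by (simp add: has_real_derivative_iff_has_vector_derivative has_vector_derivative_at_within)
    next
      show "continuous_on {0..1} (\<lambda>s. blinfun_apply (u' (s *\<^sub>R x)) x)"
        by (intro continuous_intros continuous_on_compose2[OF cu']) (use sc True in auto)
    qed simp
    then show ?thesis using True by (simp add: f_def)
  qed (simp add: f_def)
  have "0 \<le> (LINT s|lborel. LINT x|lborel. f (s, x))"
  proof (rule Bochner_Integration.integral_nonneg)
    fix s
    show "0 \<le> (LINT x|lborel. f (s, x))"
      using radial_derivative_integral_nonneg[OF u'' cont lap, of s]
      by (cases "s \<in> {0..1}") (simp_all add: f_def B_def set_lebesgue_integral_def)
  qed
  also have "\<dots> = (LINT x|lborel. LINT s|lborel. f (s, x))"
    using lborel_pair.Fubini_integral[of "\<lambda>s x. f (s, x)"] f by simp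
  also have "\<dots> = (LINT x|lborel. indicator B x *\<^sub>R u x - indicator B x *\<^sub>R u 0)"
    by (simp add: eq algebra_simps)
  also have "\<dots> = (LINT x|lborel. indicator B x *\<^sub>R u x) - (LINT x|lborel. indicator B x *\<^sub>R u 0)"
    by (intro Bochner_Integration.integral_diff iu borel_integrable_compact) (auto simp: B_def)
  also have "(LINT x|lborel. indicator B x *\<^sub>R u 0) = u 0 * measure lborel B"
    by (simp add: B_def)
  finally show ?thesis by (simp add: set_lebesgue_integral_def B_def)
qed

text \<open>Matches the coordinate Laplacian with the trace of the second Frechet derivative, then
  translates the centre \<open>y\<close> to the origin.\<close>

lemma subharmonic_on_sub_mean_value:
  fixes h :: "real ^ 'n \<Rightarrow> real"
  assumes sub: "subharmonic_on G h" and G: "cball y R \<subseteq> G"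
  shows "h y * measure lborel (cball y R) \<le> (LINT x:cball y R|lborel. h x)"
proof -
  obtain h' h'' where h': "\<And>x. x \<in> G \<Longrightarrow> (h has_derivative blinfun_apply (h' x)) (at x)"
    and h'': "\<And>x. x \<in> G \<Longrightarrow> (h' has_derivative blinfun_apply (h'' x)) (at x)"
    and cont: "continuous_on G h''"
    using sub unfolding subharmonic_on_def C2_on_def by metis
  have "open G" using sub by (simp add: subharmonic_on_def)
  have pd: "partial_deriv k h x = blinfun_apply (h' x) (axis k 1)" if "x \<in> G" for k x
    unfolding partial_deriv_def
    using has_derivative_imp_has_field_derivative_line[of h "blinfun_apply (h' x)" x 0 "axis k 1"] h'[OF that]
    by (simp add: DERIV_imp_deriv)
  have pd2: "partial_deriv k (partial_deriv k h) x = blinfun_apply (blinfun_apply (h'' x) (axis k 1)) (axis k 1)"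
    if x: "x \<in> G" for k x
  proof -
    have "((\<lambda>x. blinfun_apply (h' x) (axis k 1)) has_derivative
        (\<lambda>d. blinfun_apply (blinfun_apply (h'' x) d) (axis k 1))) (at x)"
      by (rule bounded_linear.has_derivative[OF blinfun.bounded_linear_left h''[OF x]])
    \<comment> \<open>The partial derivative is known to be a component of \<open>h'\<close> only on
      \<open>G\<close>; openness of \<open>G\<close> lets this local agreement determine its
      derivative at \<open>x\<close>.\<close>
    then have "(partial_deriv k h has_derivative
        (\<lambda>d. blinfun_apply (blinfun_apply (h'' x) d) (axis k 1))) (at x)"
      by (rule has_derivative_transform_within_open[OF _ \<open>open G\<close> x]) (simp add: pd)
    then show ?thesis
      using has_derivative_imp_has_field_derivative_line[of "partial_deriv k h"
          "\<lambda>d. blinfun_apply (blinfun_apply (h'' x) d) (axis k 1)" x 0 "axis k 1"]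
      by (simp add: DERIV_imp_deriv partial_deriv_def[of k "partial_deriv k h"])
  qed
  have lap: "0 \<le> (\<Sum>b\<in>Basis. blinfun_apply (blinfun_apply (h'' x) b) b)" if x: "x \<in> G" for x
  proof -
    have "(Basis :: (real ^ 'n) set) = range (\<lambda>k. axis k 1)"
      by (auto simp: Basis_vec_def)
    moreover have "inj (\<lambda>k::'n. axis k (1::real))" by (auto simp: inj_def axis_eq_axis)
    ultimately have "(\<Sum>b\<in>Basis. blinfun_apply (blinfun_apply (h'' x) b) b) =
        (\<Sum>k\<in>UNIV. blinfun_apply (blinfun_apply (h'' x) (axis k 1)) (axis k 1))"
      by (metis (no_types, lifting) sum.reindex_cong)
    also have "\<dots> = (\<Sum>k\<in>UNIV. partial_deriv k (partial_deriv k h) x)"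
      by (simp add: pd2[OF x])
    finally have "(\<Sum>b\<in>Basis. blinfun_apply (blinfun_apply (h'' x) b) b) =
        (\<Sum>k\<in>UNIV. partial_deriv k (partial_deriv k h) x)" .
    then show ?thesis using sub x by (simp add: subharmonic_on_def)
  qed
  have G': "y + x \<in> G" if "x \<in> cball 0 R" for x
    using G that by (auto simp: subset_iff dist_norm)
  have shift: "((+) y has_derivative (\<lambda>d. d)) (at x)" for x
    by (auto intro!: derivative_eq_intros)
  have "h (y + 0) * measure lborel (cball (0::real^'n) R) \<le> (LINT x:cball 0 R|lborel. h (y + x))"
  proof (rule sub_mean_value_cball_0[where u = "\<lambda>x. h (y + x)" and u' = "\<lambda>x. h' (y + x)"
        and u'' = "\<lambda>x. h'' (y + x)"])
    fix x :: "real ^ 'n" assume "x \<in> cball 0 R"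
    note x = G'[OF this]
    show "((\<lambda>x. h (y + x)) has_derivative blinfun_apply (h' (y + x))) (at x)"
      using has_derivative_compose[OF shift h'[OF x]] .
    show "((\<lambda>x. h' (y + x)) has_derivative blinfun_apply (h'' (y + x))) (at x)"
      using has_derivative_compose[OF shift h''[OF x]] .
    show "0 \<le> (\<Sum>b\<in>Basis. blinfun_apply (blinfun_apply (h'' (y + x)) b) b)"
      by (rule lap[OF x])
  next
    show "continuous_on (cball 0 R) (\<lambda>x. h'' (y + x))"
      by (rule continuous_on_compose2[OF cont]) (use G in \<open>auto intro!: continuous_intros simp: subset_iff\<close>)
  qed
  also have "measure lborel (cball (0::real^'n) R) = measure lborel (cball y R)"
    by (cases "R \<ge> 0") (simp_all add: content_cball)
  also have "(LINT x:cball 0 R|lborel. h (y + x)) = (LINT x:cball y R|lborel. h x)"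
  proof -
    have "continuous_on (cball y R) h"
      using h' G by (meson continuous_at_imp_continuous_on has_derivative_continuous subsetD)
    then have "integrable lborel (\<lambda>x. indicator (cball y R) x *\<^sub>R h x)"
      by (intro borel_integrable_compact) auto
    from lborel_integral_translate(2)[OF this[unfolded real_scaleR_def], of y]
    show ?thesis
      by (simp add: set_lebesgue_integral_def add.commute indicator_def dist_norm)
  qed
  finally show ?thesis by simp
qed

subsection \<open>Interference and marked Poisson points\<close>

lemma measurable_path_loss [measurable]: "path_loss c \<alpha> \<in> borel_measurable borel"
  unfolding path_loss_def by measurable

text \<open>In \<open>[0, \<infinity>]\<close> every family is summable, so the unordered sum over
  the points is a series along any enumeration without repetition. The series form serves for
  measurability and for comparison with a single term.\<close>

lemma interference_eq_suminf:
  assumes bij: "bij_betw x {n. enat n < N} P"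
    and mark: "\<And>n. enat n < N \<Longrightarrow> mark (x n) = m n"
  shows "interference c \<alpha> P mark y =
    (\<Sum>n. if enat n < N then ennreal (m n) * path_loss c \<alpha> (norm (x n - y)) else 0)"
proof -
  have "interference c \<alpha> P mark y =
      (\<Sum>\<^sub>\<infinity>n\<in>{n. enat n < N}. ennreal (mark (x n)) * path_loss c \<alpha> (norm (x n - y)))"
    unfolding interference_def by (rule infsum_reindex_bij_betw[OF bij, symmetric])
  also have "\<dots> = (\<Sum>\<^sub>\<infinity>n. if enat n < N then ennreal (m n) * path_loss c \<alpha> (norm (x n - y)) else 0)"
    by (rule infsum_cong_neutral) (auto simp: mark)
  also have "\<dots> = (\<Sum>n. if enat n < N then ennreal (m n) * path_loss c \<alpha> (norm (x n - y)) else 0)"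
    by (intro sums_unique has_sum_imp_sums has_sum_infsum nonneg_summable_on_complete) simp
  finally show ?thesis .
qed

text \<open>The path loss decreases, so a mark that reaches the threshold at the outer radius
  \<open>s\<close> suffices at every smaller distance. The condition \<open>0 < r\<close> keeps
  \<open>c + r powr \<alpha>\<close> positive even when \<open>c = 0\<close>.\<close>

lemma ennreal_le_mult_path_loss:
  assumes "c \<ge> 0" "0 \<le> \<alpha>" "0 < r" "r \<le> s" "0 \<le> z" and m: "z * (c + s powr \<alpha>) \<le> m"
  shows "ennreal z \<le> ennreal m * path_loss c \<alpha> r"
proof -
  have pos: "c + r powr \<alpha> > 0" using assms by (simp add: add_nonneg_pos)
  have "z * (c + r powr \<alpha>) \<le> z * (c + s powr \<alpha>)"
    using assms by (intro mult_left_mono add_left_mono powr_mono2) auto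
  then have m': "z * (c + r powr \<alpha>) \<le> m" using m by linarith
  then have "m \<ge> 0" using pos \<open>0 \<le> z\<close> by (meson mult_nonneg_nonneg less_imp_le order_trans)
  have "ennreal m * path_loss c \<alpha> r = ennreal (m / (c + r powr \<alpha>))"
    unfolding path_loss_def using pos \<open>m \<ge> 0\<close>
    by (simp add: inverse_ennreal ennreal_mult[symmetric] divide_inverse)
  moreover have "z \<le> m / (c + r powr \<alpha>)" using m' pos by (simp add: pos_le_divide_eq)
  ultimately show ?thesis by (simp add: ennreal_leI)
qed

section \<open>Void probabilities: averaging over the marks, then over the Poisson counts\<close>

text \<open>The generating function of the Poisson law, summed by the exponential series. It will be
  evaluated at the probability that a single mark stays below its threshold.\<close>

lemma (in prob_space) expectation_power_poisson:
  fixes C :: "'a \<Rightarrow> nat"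
  assumes C[measurable]: "C \<in> measurable M (count_space UNIV)"
    and poisson: "\<And>k. prob {\<omega>\<in>space M. C \<omega> = k} = \<Lambda> ^ k / fact k * exp (- \<Lambda>)"
    and s: "0 \<le> s" and \<Lambda>: "0 \<le> \<Lambda>"
  shows "expectation (\<lambda>\<omega>. s ^ C \<omega>) = exp (- ((1 - s) * \<Lambda>))"
proof -
  have "(\<integral>\<^sup>+\<omega>. ennreal (s ^ C \<omega>) \<partial>M) = (\<integral>\<^sup>+\<omega>. (\<Sum>k. ennreal (s ^ k) * indicator {\<omega>\<in>space M. C \<omega> = k} \<omega>) \<partial>M)"
  proof (rule nn_integral_cong)
    fix \<omega> assume "\<omega> \<in> space M"
    then have "(\<lambda>k. ennreal (s ^ k) * indicator {\<omega>\<in>space M. C \<omega> = k} \<omega>) =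
        (\<lambda>k. if k = C \<omega> then ennreal (s ^ k) else 0)"
      by (auto simp: fun_eq_iff)
    then show "ennreal (s ^ C \<omega>) = (\<Sum>k. ennreal (s ^ k) * indicator {\<omega>\<in>space M. C \<omega> = k} \<omega>)"
      using sums_single[of "C \<omega>" "\<lambda>k. ennreal (s ^ k)"] by (simp add: sums_iff)
  qed
  also have "\<dots> = (\<Sum>k. \<integral>\<^sup>+\<omega>. ennreal (s ^ k) * indicator {\<omega>\<in>space M. C \<omega> = k} \<omega> \<partial>M)"
    by (rule nn_integral_suminf) measurable
  also have "\<dots> = (\<Sum>k. ennreal (s ^ k * (\<Lambda> ^ k / fact k * exp (- \<Lambda>))))"
    by (simp add: nn_integral_cmult_indicator emeasure_eq_measure poisson ennreal_mult[symmetric] s \<Lambda>)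
  also have "\<dots> = ennreal (exp (s * \<Lambda>) * exp (- \<Lambda>))"
  proof (rule suminf_ennreal_eq)
    have "(\<lambda>k. (s * \<Lambda>) ^ k / fact k) sums exp (s * \<Lambda>)"
      using exp_converges[of "s * \<Lambda>"] by (simp add: divide_inverse mult.commute)
    from sums_mult2[OF this, of "exp (- \<Lambda>)"]
    show "(\<lambda>k. s ^ k * (\<Lambda> ^ k / fact k * exp (- \<Lambda>))) sums (exp (s * \<Lambda>) * exp (- \<Lambda>))"
      by (simp add: power_mult_distrib mult_ac)
  qed (use s \<Lambda> in simp)
  also have "exp (s * \<Lambda>) * exp (- \<Lambda>) = exp (- ((1 - s) * \<Lambda>))"
    by (simp add: exp_add[symmetric] algebra_simps)
  finally show ?thesis
    using s by (intro integral_eq_nn_integral[THEN trans]) auto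
qed

text \<open>The label of a point says which annulus it lies in; the label 0 stands for ``no constraint'' and
  also covers the indices beyond \<open>N\<close>.\<close>

lemma (in prob_space) prob_marks_label:
  fixes N :: "'a \<Rightarrow> enat" and X :: "nat \<Rightarrow> 'a \<Rightarrow> 'b::euclidean_space" and m :: "nat \<Rightarrow> 'a \<Rightarrow> real"
    and lab :: "'b \<Rightarrow> nat"
  assumes N[measurable]: "N \<in> measurable M (count_space UNIV)"
    and X[measurable]: "\<And>n. X n \<in> borel_measurable M"
    and m: "indep_vars (\<lambda>_. borel) m UNIV"
    and NXm: "indep_set
          (sets (vimage_algebra (space M) (\<lambda>\<omega>. (N \<omega>, \<lambda>n. X n \<omega>))
             (count_space UNIV \<Otimes>\<^sub>M (\<Pi>\<^sub>M n\<in>UNIV. borel))))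
          (sets (vimage_algebra (space M) (\<lambda>\<omega> n. m n \<omega>) (\<Pi>\<^sub>M n\<in>UNIV. borel)))"
    and lab[measurable]: "lab \<in> measurable borel (count_space UNIV)"
    and lab_le: "\<And>x. lab x \<le> n"
    and T[measurable]: "\<And>i. T i \<in> sets borel"
    and p: "\<And>k i. prob {\<omega>\<in>space M. m k \<omega> \<in> T i} = p i"
    and L: "\<And>k \<omega>. L k \<omega> = (if enat k < N \<omega> then lab (X k \<omega>) else 0)"
  shows "prob {\<omega>\<in>space M. \<forall>k<K. m k \<omega> \<in> T (L k \<omega>)} = expectation (\<lambda>\<omega>. \<Prod>k<K. p (L k \<omega>))"
proof -
  have m_meas[measurable]: "m k \<in> borel_measurable M" for k
    using m by (auto simp: indep_vars_def)
  have L_meas[measurable]: "L k \<in> measurable M (count_space UNIV)" for k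
    unfolding L[abs_def] by measurable
  \<comment> \<open>Only finitely many label patterns occur on the first \<open>K\<close> indices.
    Taking extensional functions makes the pattern of an outcome unique, so the events
    \<open>A l\<close> with \<open>l\<close> in \<open>P\<close> partition the sample space.\<close>
  define P where "P = PiE {..<K} (\<lambda>_. {..n})"
  define A where "A l = {\<omega>\<in>space M. \<forall>k<K. L k \<omega> = l k}" for l
  define B where "B l = {\<omega>\<in>space M. \<forall>k<K. m k \<omega> \<in> T (l k)}" for l
  have "finite P" by (simp add: P_def finite_PiE)
  have [measurable]: "A l \<in> events" "B l \<in> events" for l
    unfolding A_def B_def by measurable
  have L_le: "L k \<omega> \<le> n" for k \<omega> by (simp add: L lab_le)
  have ex: "\<exists>l\<in>P. \<forall>k<K. L k \<omega> = l k" for \<omega>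
    by (rule bexI[of _ "\<lambda>k\<in>{..<K}. L k \<omega>"]) (auto simp: P_def L_le)
  have uniq: "l = l'" if "\<omega> \<in> A l" "\<omega> \<in> A l'" "l \<in> P" "l' \<in> P" for l l' \<omega>
    using that unfolding A_def P_def by (intro PiE_ext[of l "{..<K}" "\<lambda>_. {..n}" l']) auto
  \<comment> \<open>\<open>A l\<close> is determined by the enumeration and \<open>B l\<close> by
    the marks, so they are independent; once the pattern is fixed, the probability of
    \<open>B l\<close> factorises over the independent marks.\<close>
  have AB: "prob (A l \<inter> B l) = prob (A l) * (\<Prod>k<K. p (l k))" for l
  proof -
    have "A l = (\<lambda>\<omega>. (N \<omega>, \<lambda>n. X n \<omega>)) -` {q \<in> space (count_space UNIV \<Otimes>\<^sub>M (\<Pi>\<^sub>M n\<in>UNIV. borel)).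
        \<forall>k<K. (if enat k < fst q then lab (snd q k) else 0) = l k} \<inter> space M"
      by (auto simp: A_def L space_pair_measure space_PiM)
    also have "\<dots> \<in> sets (vimage_algebra (space M) (\<lambda>\<omega>. (N \<omega>, \<lambda>n. X n \<omega>))
             (count_space UNIV \<Otimes>\<^sub>M (\<Pi>\<^sub>M n\<in>UNIV. borel)))"
      by (rule in_vimage_algebra) measurable
    finally have A: "A l \<in> \<dots>" .
    have "B l = (\<lambda>\<omega> n. m n \<omega>) -` {q \<in> space (\<Pi>\<^sub>M n\<in>UNIV. borel). \<forall>k<K. q k \<in> T (l k)} \<inter> space M"
      by (auto simp: B_def space_PiM)
    also have "\<dots> \<in> sets (vimage_algebra (space M) (\<lambda>\<omega> n. m n \<omega>) (\<Pi>\<^sub>M n\<in>UNIV. borel))"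
      by (rule in_vimage_algebra) measurable
    finally have B: "B l \<in> \<dots>" .
    have "prob (B l) = (\<Prod>k<K. p (l k))"
    proof (cases "K = 0")
      case False
      have "B l = (\<Inter>k\<in>{..<K}. m k -` T (l k) \<inter> space M)"
        using False by (auto simp: B_def)
      also have "prob \<dots> = (\<Prod>k<K. prob (m k -` T (l k) \<inter> space M))"
        using False by (intro indep_varsD[OF m]) auto
      also have "\<dots> = (\<Prod>k<K. p (l k))"
        by (intro prod.cong refl, subst p[symmetric]) (auto intro!: arg_cong[where f=prob])
      finally show ?thesis .
    qed (simp add: B_def prob_space)
    then show ?thesis using indep_setD[OF NXm A B] by simp
  qed
  have "{\<omega>\<in>space M. \<forall>k<K. m k \<omega> \<in> T (L k \<omega>)} = (\<Union>l\<in>P. A l \<inter> B l)"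
  proof (intro equalityI subsetI)
    fix \<omega> assume \<omega>: "\<omega> \<in> {\<omega>\<in>space M. \<forall>k<K. m k \<omega> \<in> T (L k \<omega>)}"
    obtain l where "l \<in> P" "\<forall>k<K. L k \<omega> = l k" using ex by blast
    then show "\<omega> \<in> (\<Union>l\<in>P. A l \<inter> B l)" using \<omega> by (auto simp: A_def B_def)
  qed (auto simp: A_def B_def)
  also have "prob \<dots> = (\<Sum>l\<in>P. prob (A l \<inter> B l))"
  proof (rule finite_measure_finite_Union[OF \<open>finite P\<close>])
    show "disjoint_family_on (\<lambda>l. A l \<inter> B l) P"
      unfolding disjoint_family_on_def using uniq by blast
  qed auto
  also have "\<dots> = (\<Sum>l\<in>P. expectation (\<lambda>\<omega>. indicator (A l) \<omega> * (\<Prod>k<K. p (l k))))"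
    by (simp add: AB)
  also have "\<dots> = expectation (\<lambda>\<omega>. \<Sum>l\<in>P. indicator (A l) \<omega> * (\<Prod>k<K. p (l k)))"
    by (rule Bochner_Integration.integral_sum[symmetric]) (intro integrable_mult_left integrable_real_indicator, simp_all add: emeasure_eq_measure)
  also have "\<dots> = expectation (\<lambda>\<omega>. \<Prod>k<K. p (L k \<omega>))"
  proof (intro Bochner_Integration.integral_cong refl)
    fix \<omega> assume \<omega>: "\<omega> \<in> space M"
    obtain l where l: "l \<in> P" "\<forall>k<K. L k \<omega> = l k" using ex by blast
    then have "\<omega> \<in> A l" using \<omega> by (simp add: A_def)
    then have "(\<Sum>l'\<in>P. indicator (A l') \<omega> * (\<Prod>k<K. p (l' k))) =
        (\<Sum>l'\<in>P. if l' = l then (\<Prod>k<K. p (l' k)) else 0)"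
      using uniq l by (intro sum.cong refl) (auto simp: indicator_def)
    also have "\<dots> = (\<Prod>k<K. p (L k \<omega>))"
      using l \<open>finite P\<close> by simp
    finally show "(\<Sum>l'\<in>P. indicator (A l') \<omega> * (\<Prod>k<K. p (l' k))) = (\<Prod>k<K. p (L k \<omega>))" .
  qed
  finally show ?thesis .
qed

lemma prod_power_card_vimage:
  fixes p :: "nat \<Rightarrow> real"
  assumes J: "finite J" and l: "\<And>k. k \<in> J \<Longrightarrow> l k \<in> I" and "finite I"
  shows "(\<Prod>k\<in>J. p (l k)) = (\<Prod>i\<in>I. p i ^ card {k \<in> J. l k = i})"
proof -
  have "(\<Prod>k\<in>J. p (l k)) = (\<Prod>i\<in>I. \<Prod>k\<in>{k \<in> J. l k = i}. p (l k))"
    using l by (intro prod.group[symmetric] J \<open>finite I\<close>) auto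
  also have "\<dots> = (\<Prod>i\<in>I. p i ^ card {k \<in> J. l k = i})"
    by (intro prod.cong refl) simp
  finally show ?thesis .
qed

text \<open>Passage from the first \<open>K\<close> points to all of them. The full event lies in
  every truncated one, and the truncated products are eventually constant: finitely many indices
  have a nonzero label, and label 0 contributes the factor \<open>p 0 = 1\<close>. Dominated
  convergence with bound 1 gives the limit.\<close>

lemma (in prob_space) prob_marks_label_le:
  fixes N :: "'a \<Rightarrow> enat" and X :: "nat \<Rightarrow> 'a \<Rightarrow> 'b::euclidean_space" and m :: "nat \<Rightarrow> 'a \<Rightarrow> real"
    and lab :: "'b \<Rightarrow> nat"
  assumes N[measurable]: "N \<in> measurable M (count_space UNIV)"
    and X[measurable]: "\<And>n. X n \<in> borel_measurable M"
    and bij: "\<And>\<omega>. \<omega> \<in> space M \<Longrightarrow> bij_betw (\<lambda>n. X n \<omega>) {n. enat n < N \<omega>} (\<Phi> \<omega>)"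
    and m: "indep_vars (\<lambda>_. borel) m UNIV"
    and NXm: "indep_set
          (sets (vimage_algebra (space M) (\<lambda>\<omega>. (N \<omega>, \<lambda>n. X n \<omega>))
             (count_space UNIV \<Otimes>\<^sub>M (\<Pi>\<^sub>M n\<in>UNIV. borel))))
          (sets (vimage_algebra (space M) (\<lambda>\<omega> n. m n \<omega>) (\<Pi>\<^sub>M n\<in>UNIV. borel)))"
    and lab[measurable]: "lab \<in> measurable borel (count_space UNIV)"
    and lab_le: "\<And>x. lab x \<le> n"
    and fin: "\<And>\<omega> i. \<omega> \<in> space M \<Longrightarrow> i \<in> {1..n} \<Longrightarrow> finite (\<Phi> \<omega> \<inter> {x. lab x = i})"
    and T[measurable]: "\<And>i. T i \<in> sets borel" and T0: "T 0 = UNIV"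
    and p: "\<And>k i. prob {\<omega>\<in>space M. m k \<omega> \<in> T i} = p i"
  shows "prob {\<omega>\<in>space M. \<forall>k. enat k < N \<omega> \<longrightarrow> m k \<omega> \<in> T (lab (X k \<omega>))}
    \<le> expectation (\<lambda>\<omega>. \<Prod>i\<in>{1..n}. p i ^ card (\<Phi> \<omega> \<inter> {x. lab x = i}))"
proof -
  define L where "L k \<omega> = (if enat k < N \<omega> then lab (X k \<omega>) else 0)" for k \<omega>
  have m_meas[measurable]: "m k \<in> borel_measurable M" for k
    using m by (auto simp: indep_vars_def)
  have L_meas[measurable]: "L k \<in> measurable M (count_space UNIV)" for k
    unfolding L_def[abs_def] by measurable
  have p01: "0 \<le> p i" "p i \<le> 1" for i using p[of 0 i] by (metis measure_nonneg, metis prob_le_1)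
  have p0: "p 0 = 1" using p[of 0 0] by (simp add: T0 prob_space)
  have lim: "(\<lambda>K. \<Prod>k<K. p (L k \<omega>)) \<longlonglongrightarrow> (\<Prod>i\<in>{1..n}. p i ^ card (\<Phi> \<omega> \<inter> {x. lab x = i}))"
    if \<omega>: "\<omega> \<in> space M" for \<omega>
  proof -
    define J where "J = {k. L k \<omega> \<noteq> 0}"
    \<comment> \<open>The enumeration has no repetitions, so indices with label \<open>i\<close>
      correspond to points with that label. The value 0 is excluded because it also marks the
      indices beyond \<open>N\<close>.\<close>
    have Ji: "bij_betw (\<lambda>n. X n \<omega>) {k. L k \<omega> = i} (\<Phi> \<omega> \<inter> {x. lab x = i})" if "i \<noteq> 0" for i
    proof (rule bij_betw_subset[OF bij[OF \<omega>]])
      show "{k. L k \<omega> = i} \<subseteq> {n. enat n < N \<omega>}" using that by (auto simp: L_def split: if_splits)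
      have "\<Phi> \<omega> = (\<lambda>n. X n \<omega>) ` {n. enat n < N \<omega>}" using bij[OF \<omega>] by (simp add: bij_betw_def)
      then show "(\<lambda>n. X n \<omega>) ` {k. L k \<omega> = i} = \<Phi> \<omega> \<inter> {x. lab x = i}"
        using that by (auto simp: L_def image_iff split: if_splits)
    qed
    have L_le: "L k \<omega> \<le> n" for k by (simp add: L_def lab_le)
    have "J = (\<Union>i\<in>{1..n}. {k. L k \<omega> = i})" using L_le by (auto simp: J_def Suc_le_eq)
    moreover have "finite {k. L k \<omega> = i}" if "i \<in> {1..n}" for i
      using bij_betw_finite[OF Ji[of i]] fin[OF \<omega> that] that by auto
    ultimately have "finite J" by simp
    then obtain K0 where K0: "\<And>k. k \<in> J \<Longrightarrow> k < K0"
      using finite_nat_bounded by blast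
    have "(\<Prod>k<K. p (L k \<omega>)) = (\<Prod>i\<in>{1..n}. p i ^ card (\<Phi> \<omega> \<inter> {x. lab x = i}))" if "K0 \<le> K" for K
    proof -
      have "(\<Prod>k<K. p (L k \<omega>)) = (\<Prod>k\<in>J. p (L k \<omega>))"
        using K0 that by (intro prod.mono_neutral_right) (auto simp: J_def p0 dest: less_le_trans)
      also have "\<dots> = (\<Prod>i\<in>{1..n}. p i ^ card {k \<in> J. L k \<omega> = i})"
        using L_le by (intro prod_power_card_vimage \<open>finite J\<close>) (auto simp: J_def Suc_le_eq)
      also have "\<dots> = (\<Prod>i\<in>{1..n}. p i ^ card (\<Phi> \<omega> \<inter> {x. lab x = i}))"
      proof (intro prod.cong refl)
        fix i assume i: "i \<in> {1..n}"
        then have "{k \<in> J. L k \<omega> = i} = {k. L k \<omega> = i}" by (auto simp: J_def)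
        then show "p i ^ card {k \<in> J. L k \<omega> = i} = p i ^ card (\<Phi> \<omega> \<inter> {x. lab x = i})"
          using bij_betw_same_card[OF Ji[of i]] i by simp
      qed
      finally show ?thesis .
    qed
    then show ?thesis
      by (intro tendsto_eventually eventually_sequentiallyI[of K0])
  qed
  have "(\<lambda>K. expectation (\<lambda>\<omega>. \<Prod>k<K. p (L k \<omega>))) \<longlonglongrightarrow>
      expectation (\<lambda>\<omega>. \<Prod>i\<in>{1..n}. p i ^ card (\<Phi> \<omega> \<inter> {x. lab x = i}))"
  proof (rule integral_dominated_convergence[where w = "\<lambda>_. 1"])
    show "(\<lambda>\<omega>. \<Prod>i\<in>{1..n}. p i ^ card (\<Phi> \<omega> \<inter> {x. lab x = i})) \<in> borel_measurable M"
      by (rule borel_measurable_LIMSEQ_real[OF lim]) measurable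
    show "AE \<omega> in M. norm (\<Prod>k<K. p (L k \<omega>)) \<le> 1" for K
      by (intro AE_I2) (simp add: abs_prod p01 prod_le_1)
  qed (use lim in auto)
  moreover have "prob {\<omega>\<in>space M. \<forall>k. enat k < N \<omega> \<longrightarrow> m k \<omega> \<in> T (lab (X k \<omega>))}
      \<le> expectation (\<lambda>\<omega>. \<Prod>k<K. p (L k \<omega>))" for K
  proof -
    have "prob {\<omega>\<in>space M. \<forall>k. enat k < N \<omega> \<longrightarrow> m k \<omega> \<in> T (lab (X k \<omega>))}
      \<le> prob {\<omega>\<in>space M. \<forall>k<K. m k \<omega> \<in> T (L k \<omega>)}"
      by (rule finite_measure_mono) (auto simp: L_def T0)
    also have "\<dots> = expectation (\<lambda>\<omega>. \<Prod>k<K. p (L k \<omega>))"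
      by (rule prob_marks_label[OF N X m NXm lab lab_le T p]) (rule L_def)
    finally show ?thesis .
  qed
  ultimately show ?thesis by (intro LIMSEQ_le_const) auto
qed

text \<open>A void probability of an independent thinning: a point with label \<open>i\<close>
  violates its constraint with probability \<open>1 - p i\<close>. Independence of the counts in
  disjoint sets factorises the expectation, and each factor is a Poisson generating function at
  \<open>p i\<close>.\<close>

lemma (in prob_space) prob_marked_poisson_void_le:
  fixes lab :: "'b::euclidean_space \<Rightarrow> nat" and X :: "nat \<Rightarrow> 'a \<Rightarrow> 'b" and m :: "nat \<Rightarrow> 'a \<Rightarrow> real"
    and N :: "'a \<Rightarrow> enat"
  assumes ppp: "poisson_point_process M intens \<Phi>"
    and N: "N \<in> measurable M (count_space UNIV)"
    and X: "\<And>n. X n \<in> borel_measurable M"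
    and bij: "\<And>\<omega>. \<omega> \<in> space M \<Longrightarrow> bij_betw (\<lambda>n. X n \<omega>) {n. enat n < N \<omega>} (\<Phi> \<omega>)"
    and m: "indep_vars (\<lambda>_. borel) m UNIV"
    and NXm: "indep_set
          (sets (vimage_algebra (space M) (\<lambda>\<omega>. (N \<omega>, \<lambda>n. X n \<omega>))
             (count_space UNIV \<Otimes>\<^sub>M (\<Pi>\<^sub>M n\<in>UNIV. borel))))
          (sets (vimage_algebra (space M) (\<lambda>\<omega> n. m n \<omega>) (\<Pi>\<^sub>M n\<in>UNIV. borel)))"
    and lab[measurable]: "lab \<in> measurable borel (count_space UNIV)"
    and lab_le: "\<And>x. lab x \<le> n"
    and bdd: "\<And>i. i \<in> {1..n} \<Longrightarrow> bounded {x. lab x = i}"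
    and T: "\<And>i. T i \<in> sets borel" and T0: "T 0 = UNIV"
    and p: "\<And>k i. prob {\<omega>\<in>space M. m k \<omega> \<in> T i} = p i"
  shows "prob {\<omega>\<in>space M. \<forall>k. enat k < N \<omega> \<longrightarrow> m k \<omega> \<in> T (lab (X k \<omega>))}
    \<le> exp (- (\<Sum>i=1..n. (1 - p i) * (LINT x:{x. lab x = i}|lborel. intens x)))"
proof -
  define A where "A i = {x. lab x = i}" for i
  have A: "A i \<in> sets borel" for i
    unfolding A_def using measurable_sets[OF lab, of "{i}"] by (simp add: vimage_def)
  have C: "(\<lambda>\<omega>. card (\<Phi> \<omega> \<inter> A i)) \<in> measurable M (count_space UNIV)" if "i \<in> {1..n}" for i
    using ppp A bdd[OF that] by (auto simp: poisson_point_process_def A_def)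
  have p01: "0 \<le> p i" "p i \<le> 1" for i using p[of 0 i] by (metis measure_nonneg, metis prob_le_1)
  have "prob {\<omega>\<in>space M. \<forall>k. enat k < N \<omega> \<longrightarrow> m k \<omega> \<in> T (lab (X k \<omega>))}
      \<le> expectation (\<lambda>\<omega>. \<Prod>i\<in>{1..n}. p i ^ card (\<Phi> \<omega> \<inter> A i))"
  proof -
    have fin: "finite (\<Phi> \<omega> \<inter> {x. lab x = i})" if "\<omega> \<in> space M" "i \<in> {1..n}" for \<omega> i
      using ppp bdd that by (auto simp: poisson_point_process_def)
    show ?thesis
      unfolding A_def
      by (rule prob_marks_label_le[where \<Phi> = \<Phi> and X = X and m = m and lab = lab and T = T and p = p,
            OF N X bij m NXm lab lab_le fin T T0 p])
  qed
  also have "\<dots> = (\<Prod>i\<in>{1..n}. expectation (\<lambda>\<omega>. p i ^ card (\<Phi> \<omega> \<inter> A i)))"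
  proof (rule indep_vars_lebesgue_integral)
    have "indep_vars (\<lambda>_. count_space UNIV) (\<lambda>i \<omega>. card (\<Phi> \<omega> \<inter> A i)) {1..n}"
    proof -
      have "disjoint_family_on A {1..n}" by (auto simp: disjoint_family_on_def A_def)
      moreover have "\<forall>i\<in>{1..n}. A i \<in> sets borel \<and> bounded (A i)"
        using A bdd by (simp add: A_def)
      ultimately show ?thesis
        using ppp finite_atLeastAtMost[of 1 n] unfolding poisson_point_process_def by meson
    qed
    then show "indep_vars (\<lambda>_. borel) (\<lambda>i \<omega>. p i ^ card (\<Phi> \<omega> \<inter> A i)) {1..n}"
      by (rule indep_vars_compose2) simp
    show "integrable M (\<lambda>\<omega>. p i ^ card (\<Phi> \<omega> \<inter> A i))" if "i \<in> {1..n}" for i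
      using C[OF that] by (intro integrable_const_bound[of _ 1]) (auto simp: p01 power_le_one)
  qed simp
  also have "\<dots> = (\<Prod>i\<in>{1..n}. exp (- ((1 - p i) * (LINT x:A i|lborel. intens x))))"
  proof (intro prod.cong refl expectation_power_poisson C p01)
    fix i assume i: "i \<in> {1..n}"
    show "prob {\<omega>\<in>space M. card (\<Phi> \<omega> \<inter> A i) = k} =
        (LINT x:A i|lborel. intens x) ^ k / fact k * exp (- (LINT x:A i|lborel. intens x))" for k
      using ppp A[of i] bdd[OF i] unfolding poisson_point_process_def A_def[symmetric] by meson
    show "0 \<le> (LINT x:A i|lborel. intens x)"
      using ppp unfolding set_lebesgue_integral_def
      by (intro Bochner_Integration.integral_nonneg) (simp add: poisson_point_process_def)
  qed
  finally show ?thesis by (simp add: exp_sum A_def flip: sum_negf)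
qed

subsection \<open>Summation over annuli\<close>

text \<open>Summation by parts: as \<open>e 0 = 0\<close>, the sum is \<open>h n * e n\<close> plus
  the terms \<open>(h i - h (Suc i)) * e i\<close> for \<open>0 < i < n\<close>, which are
  nonnegative. Below, \<open>e i\<close> is the excess of the mass of a disc over its lower
  bound.\<close>

lemma sum_antimono_increments_ge:
  fixes h e :: "nat \<Rightarrow> real"
  assumes "\<And>i. h (Suc i) \<le> h i" and "\<And>i. i \<le> n \<Longrightarrow> 0 \<le> e i" and "e 0 = 0"
  shows "h n * e n \<le> (\<Sum>i=1..n. h i * (e i - e (i - 1)))"
  using assms(2)
proof (induction n)
  case (Suc n)
  have "h (Suc n) * e n \<le> h n * e n"
    using assms(1) Suc.prems by (intro mult_right_mono) auto
  with Suc show ?case by (simp add: algebra_simps)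
qed (simp add: assms)

text \<open>An upper Riemann sum in the variable \<open>r\<^sup>2\<close>: between consecutive radii
  the integral of \<open>r\<close> is always \<open>\<delta> / 2\<close>, and the decreasing
  \<open>h\<close> is at most its value at the left end.\<close>

lemma set_integral_antimono_le_sum:
  fixes h :: "real \<Rightarrow> real"
  assumes h[measurable]: "h \<in> borel_measurable borel"
    and anti: "\<And>x y. 0 \<le> x \<Longrightarrow> x \<le> y \<Longrightarrow> h y \<le> h x"
    and nn: "\<And>x. 0 \<le> h x" and \<delta>: "0 \<le> \<delta>"
  shows "set_integrable lborel {0..sqrt (real n * \<delta>)} (\<lambda>r. r * h r)" (is ?int)
    and "(LINT r:{0..sqrt (real n * \<delta>)}|lborel. r * h r) \<le> \<delta> / 2 * (\<Sum>i<n. h (sqrt (real i * \<delta>)))"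
      (is ?le)
proof -
  have int: "set_integrable lborel {0..t} (\<lambda>r. r * h r)" for t
  proof (rule set_integrable_bound)
    show "set_integrable lborel {0..t} (\<lambda>r. r * h 0)"
      by (rule borel_integrable_atLeastAtMost') (intro continuous_intros)
    show "AE x in lborel. x \<in> {0..t} \<longrightarrow> norm (x * h x) \<le> norm (x * h 0)"
      using anti nn by (intro AE_I2) (simp add: abs_mult mult_left_mono)
  qed (simp add: set_borel_measurable_def)
  then show ?int .
  show ?le
  proof (induction n)
    case 0
    have "(\<lambda>r. indicat_real {0} r *\<^sub>R (r * h r)) = (\<lambda>_. 0)"
      by (auto simp: indicator_def fun_eq_iff)
    then show ?case by (simp add: set_lebesgue_integral_def)
  next
    case (Suc n)
    define a where "a = sqrt (real n * \<delta>)"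
    define b where "b = sqrt (real (Suc n) * \<delta>)"
    have ab: "0 \<le> a" "a \<le> b" using \<delta> by (auto simp: a_def b_def intro!: mult_right_mono)
    have b2: "b\<^sup>2 - a\<^sup>2 = \<delta>" using \<delta> by (simp add: a_def b_def algebra_simps)
    have intab: "set_integrable lborel {a<..b} (\<lambda>r. r * h r)"
      by (rule set_integrable_subset[OF int[of b]]) (use ab in auto)
    have lin: "set_integrable lborel {a<..b} (\<lambda>r. r * h a)"
      by (rule set_integrable_subset[OF borel_integrable_atLeastAtMost'[of a b]])
         (auto intro!: continuous_intros)
    have "(LINT r:{0..b}|lborel. r * h r) = (LINT r:{0..a} \<union> {a<..b}|lborel. r * h r)"
      using ab by (intro arg_cong2[where f = "\<lambda>A f. set_lebesgue_integral lborel A f"]) auto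
    also have "\<dots> = (LINT r:{0..a}|lborel. r * h r) + (LINT r:{a<..b}|lborel. r * h r)"
      by (rule set_integral_Un) (use int intab in auto)
    also have "(LINT r:{a<..b}|lborel. r * h r) \<le> (LINT r:{a<..b}|lborel. r * h a)"
      by (rule set_integral_mono[OF intab lin]) (use anti ab in \<open>auto intro!: mult_left_mono\<close>)
    also have "\<dots> = (LINT r:{a<..b}|lborel. r) * h a"
      by (simp add: set_lebesgue_integral_def)
    also have "(LINT r:{a<..b}|lborel. r) = (LINT r:{a..b}|lborel. r)"
    proof -
      have "AE r in lborel. r \<noteq> a" by (rule AE_lborel_singleton)
      then have "AE r in lborel. indicat_real {a<..b} r *\<^sub>R r = indicat_real {a..b} r *\<^sub>R r"
        by eventually_elim (auto simp: indicator_def)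
      then show ?thesis
        unfolding set_lebesgue_integral_def by (intro integral_cong_AE) auto
    qed
    also have "\<dots> = \<delta> / 2"
    proof -
      have "(LBINT r. indicator {a..b} r *\<^sub>R r) = b\<^sup>2 / 2 - a\<^sup>2 / 2"
        by (rule integral_FTC_atLeastAtMost[OF ab(2)])
           (auto intro!: derivative_eq_intros continuous_intros simp flip: has_real_derivative_iff_has_vector_derivative)
      then show ?thesis using b2 by (simp add: set_lebesgue_integral_def field_simps)
    qed
    finally show ?case using Suc by (simp add: a_def b_def algebra_simps)
  qed
qed

text \<open>Summation by parts replaces the mass of each annulus by \<open>a * \<delta>\<close>, the
  increment of the lower bound \<open>a * t\<^sup>2\<close> over one step \<open>\<delta>\<close> of
  the squared radii. What remains is a Riemann sum for the integral, up to the error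
  \<open>R\<^sup>2 / n\<close>.\<close>

lemma annuli_sum_ge:
  fixes f :: "'a::euclidean_space \<Rightarrow> real" and h :: "real \<Rightarrow> real"
    and r :: "nat \<Rightarrow> nat \<Rightarrow> real" and a R :: real and n :: nat
  defines "r \<equiv> \<lambda>n i. sqrt (real i * (R\<^sup>2 / real n))"
  assumes f: "\<And>t. set_integrable lborel (cball y t) f"
    and h: "h \<in> borel_measurable borel"
    and anti: "\<And>x y. 0 \<le> x \<Longrightarrow> x \<le> y \<Longrightarrow> h y \<le> h x"
    and h01: "\<And>x. 0 \<le> h x" "\<And>x. h x \<le> 1"
    and disc: "\<And>t. 0 \<le> t \<Longrightarrow> t \<le> R \<Longrightarrow> a * t\<^sup>2 \<le> (LINT x:cball y t|lborel. f x)"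
    and "0 \<le> a" "0 \<le> R" "0 < n"
  shows "a * (2 * (LINT t:{0..R}|lborel. t * h t) - R\<^sup>2 / n)
    \<le> (\<Sum>i=1..n. h (r n i) * (LINT x:cball y (r n i) - cball y (r n (i - 1))|lborel. f x))"
proof -
  define \<delta> where "\<delta> = R\<^sup>2 / real n"
  have \<delta>: "0 \<le> \<delta>" by (simp add: \<delta>_def)
  define q where "q = r n"
  have q: "q i = sqrt (real i * \<delta>)" for i by (simp add: q_def r_def \<delta>_def)
  have q_mono: "q i \<le> q j" if "i \<le> j" for i j
    using that \<delta> by (simp add: q mult_right_mono)
  have q0: "0 \<le> q i" for i using \<delta> by (simp add: q)
  have qn: "q n = R" using \<open>0 \<le> R\<close> \<open>0 < n\<close> by (simp add: q \<delta>_def)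
  have q2: "(q i)\<^sup>2 = real i * \<delta>" for i using \<delta> by (simp add: q)
  define D where "D t = (LINT x:cball y t|lborel. f x)" for t
  define e where "e i = D (q i) - a * (q i)\<^sup>2" for i
  have ann: "(LINT x:cball y (q i) - cball y (q (i - 1))|lborel. f x) = D (q i) - D (q (i - 1))" for i
  proof -
    have "D (q i) = (LINT x:cball y (q (i - 1)) \<union> (cball y (q i) - cball y (q (i - 1)))|lborel. f x)"
      unfolding D_def using q_mono[of "i - 1" i]
      by (intro arg_cong2[where f = "\<lambda>A f. set_lebesgue_integral lborel A f"]) auto
    also have "\<dots> = D (q (i - 1)) + (LINT x:cball y (q i) - cball y (q (i - 1))|lborel. f x)"
      unfolding D_def
      by (rule set_integral_Un) (auto intro: f set_integrable_subset[OF f[of "q i"]])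
    finally show ?thesis by simp
  qed
  \<comment> \<open>The disc of radius 0 is a single point, hence null; this gives the start value
    \<open>e 0 = 0\<close>.\<close>
  have "D 0 = 0"
  proof -
    have "AE x in lborel. x \<noteq> y" by (rule AE_lborel_singleton)
    then have "AE x in lborel. indicat_real (cball y 0) x *\<^sub>R f x = 0"
      by eventually_elim (auto simp: indicator_def)
    then show ?thesis
      unfolding D_def set_lebesgue_integral_def by (rule integral_eq_zero_AE)
  qed
  then have "e 0 = 0" by (simp add: e_def q)
  moreover have e: "0 \<le> e i" if "i \<le> n" for i
    using disc[OF q0[of i]] q_mono[OF that] by (simp add: e_def D_def qn)
  moreover have "h (q (Suc i)) \<le> h (q i)" for i
    by (intro anti q0 q_mono) simp
  ultimately have "h (q n) * e n \<le> (\<Sum>i=1..n. h (q i) * (e i - e (i - 1)))"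
    by (intro sum_antimono_increments_ge) auto
  moreover have "0 \<le> h (q n) * e n" using h01 e by simp
  moreover have "(\<Sum>i=1..n. h (q i) * (e i - e (i - 1))) =
      (\<Sum>i=1..n. h (q i) * (D (q i) - D (q (i - 1)))) - a * (\<delta> * (\<Sum>i=1..n. h (q i)))"
    unfolding sum_distrib_left sum_subtractf[symmetric]
  proof (intro sum.cong refl)
    fix i assume "i \<in> {1..n}"
    then have "real (i - 1) = real i - 1" by auto
    then show "h (q i) * (e i - e (i - 1)) = h (q i) * (D (q i) - D (q (i - 1))) - a * (\<delta> * h (q i))"
      by (simp add: e_def q2 algebra_simps)
  qed
  ultimately have "a * (\<delta> * (\<Sum>i=1..n. h (q i))) \<le> (\<Sum>i=1..n. h (q i) * (D (q i) - D (q (i - 1))))"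
    by linarith
  moreover have "a * (2 * (LINT t:{0..R}|lborel. t * h t) - \<delta>) \<le> a * (\<delta> * (\<Sum>i=1..n. h (q i)))"
  proof (rule mult_left_mono[OF _ \<open>0 \<le> a\<close>])
    have "(LINT t:{0..R}|lborel. t * h t) \<le> \<delta> / 2 * (\<Sum>i<n. h (q i))"
      using set_integral_antimono_le_sum(2)[OF h anti h01(1) \<delta>, of n] by (simp add: q flip: qn)
    then have "2 * (LINT t:{0..R}|lborel. t * h t) \<le> \<delta> * (\<Sum>i<n. h (q i))" by simp
    also have "\<dots> \<le> \<delta> * (1 + (\<Sum>i=1..n. h (q i)))"
    proof (rule mult_left_mono[OF _ \<delta>])
      \<comment> \<open>The integral is bounded through inner radii, the annuli carry outer radii.
        The shift costs at most the one term \<open>h (q 0) \<le> 1\<close>, which is the source of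
        the error \<open>\<delta> = R\<^sup>2 / n\<close>.\<close>
      have "(\<Sum>i<n. h (q i)) \<le> (\<Sum>i=0..n. h (q i))"
        using h01 by (intro sum_mono2) auto
      also have "\<dots> = h (q 0) + (\<Sum>i=1..n. h (q i))"
        by (simp add: sum.atLeast_Suc_atMost)
      finally show "(\<Sum>i<n. h (q i)) \<le> 1 + (\<Sum>i=1..n. h (q i))" using h01(2)[of "q 0"] by linarith
    qed
    finally show "2 * (LINT t:{0..R}|lborel. t * h t) - \<delta> \<le> \<delta> * (\<Sum>i=1..n. h (q i))"
      by (simp add: algebra_simps)
  qed
  ultimately have "a * (2 * (LINT t:{0..R}|lborel. t * h t) - \<delta>)
      \<le> (\<Sum>i=1..n. h (q i) * (D (q i) - D (q (i - 1))))"
    by linarith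
  then show ?thesis by (simp only: q_def[symmetric] ann \<delta>_def)
qed

section \<open>The tail bound from a single disc\<close>

text \<open>The probabilistic half of the argument; subharmonicity will enter only through
  \<open>disc\<close>. Interference below \<open>z\<close> forces the event \<open>E\<close> that
  every mark in an annulus stays below the threshold at its outer radius, and the void probability
  bounds \<open>prob E\<close>.\<close>

lemma (in prob_space) interference_tail_ge:
  fixes y :: "'b::euclidean_space"
  assumes ppp: "poisson_point_process M intens \<Phi>" and marks: "iid_marks M \<Phi> mark g"
    and g[measurable]: "g \<in> borel_measurable M"
    and c: "0 \<le> c" and \<alpha>: "0 \<le> \<alpha>" and z: "0 < z" and a: "0 \<le> a" and R: "0 < R"
    and disc: "\<And>t. 0 \<le> t \<Longrightarrow> t \<le> R \<Longrightarrow> a * t\<^sup>2 \<le> (LINT x:cball y t|lborel. intens x)"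
  shows "1 - exp (- (2 * a * (LINT r:{0..R}|lborel. r * prob {\<omega>\<in>space M. g \<omega> \<ge> z * (c + r powr \<alpha>)})))
    \<le> prob {\<omega>\<in>space M. interference c \<alpha> (\<Phi> \<omega>) (mark \<omega>) y \<ge> ennreal z}"
proof -
  obtain N X m where N[measurable]: "N \<in> measurable M (count_space UNIV)"
    and X[measurable]: "\<And>n. X n \<in> borel_measurable M"
    and bij: "\<And>\<omega>. \<omega> \<in> space M \<Longrightarrow> bij_betw (\<lambda>n. X n \<omega>) {n. enat n < N \<omega>} (\<Phi> \<omega>)"
    and mark: "\<And>\<omega> n. \<omega> \<in> space M \<Longrightarrow> enat n < N \<omega> \<Longrightarrow> mark \<omega> (X n \<omega>) = m n \<omega>"
    and m: "indep_vars (\<lambda>_. borel) m UNIV"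
    and m_distr: "\<And>n. distr M borel (m n) = distr M borel g"
    and NXm: "indep_set
          (sets (vimage_algebra (space M) (\<lambda>\<omega>. (N \<omega>, \<lambda>n. X n \<omega>))
             (count_space UNIV \<Otimes>\<^sub>M (\<Pi>\<^sub>M n\<in>UNIV. borel))))
          (sets (vimage_algebra (space M) (\<lambda>\<omega> n. m n \<omega>) (\<Pi>\<^sub>M n\<in>UNIV. borel)))"
    using marks unfolding iid_marks_def by blast
  have [measurable]: "m n \<in> borel_measurable M" for n
    using m by (auto simp: indep_vars_def)
  have m_prob: "prob {\<omega>\<in>space M. m k \<omega> \<in> A} = prob {\<omega>\<in>space M. g \<omega> \<in> A}" if "A \<in> sets borel" for k A
    using arg_cong[OF m_distr[of k], of "\<lambda>D. measure D A"] that
    by (simp add: measure_distr vimage_def Int_def conj_commute)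
  define I where "I \<omega> = interference c \<alpha> (\<Phi> \<omega>) (mark \<omega>) y" for \<omega>
  have I: "I \<omega> = (\<Sum>n. if enat n < N \<omega> then ennreal (m n \<omega>) * path_loss c \<alpha> (norm (X n \<omega> - y)) else 0)"
    if "\<omega> \<in> space M" for \<omega>
    unfolding I_def
    by (rule interference_eq_suminf[where x = "\<lambda>n. X n \<omega>" and m = "\<lambda>n. m n \<omega>", OF bij mark])
       (use that in auto)
  have I_meas[measurable]: "I \<in> borel_measurable M"
    by (subst measurable_cong[OF I]) measurable
  define h where "h r = prob {\<omega>\<in>space M. g \<omega> \<ge> z * (c + r powr \<alpha>)}" for r
  have h01: "0 \<le> h r" "h r \<le> 1" for r by (simp_all add: h_def)
  have anti: "h s \<le> h r" if "0 \<le> r" "r \<le> s" for r s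
  proof -
    have "z * (c + r powr \<alpha>) \<le> z * (c + s powr \<alpha>)"
      using that z \<alpha> by (intro mult_left_mono add_left_mono powr_mono2) auto
    then show ?thesis unfolding h_def by (intro finite_measure_mono) auto
  qed
  have h_meas: "h \<in> borel_measurable borel"
  proof -
    \<comment> \<open>The negated tail probability is increasing in the threshold, hence
      Borel.\<close>
    have "mono (\<lambda>t. - prob {\<omega>\<in>space M. t \<le> g \<omega>})"
      by (auto simp: mono_def intro!: finite_measure_mono)
    then have [measurable]: "(\<lambda>t. - prob {\<omega>\<in>space M. t \<le> g \<omega>}) \<in> borel_measurable borel"
      by (rule borel_measurable_mono)
    have "(\<lambda>r. - (- prob {\<omega>\<in>space M. z * (c + r powr \<alpha>) \<le> g \<omega>})) \<in> borel_measurable borel"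
      by (intro borel_measurable_uminus measurable_compose[where g = "\<lambda>t. - prob {\<omega>\<in>space M. t \<le> g \<omega>}" and N = borel])
         measurable
    then show ?thesis by (simp add: h_def[abs_def])
  qed
  define J where "J = (LINT r:{0..R}|lborel. r * h r)"
  have bound: "1 - prob {\<omega>\<in>space M. ennreal z \<le> I \<omega>} \<le> exp (- (a * (2 * J - R\<^sup>2 / n)))" if n: "0 < n" for n :: nat
  proof -
    define \<delta> where "\<delta> = R\<^sup>2 / real n"
    have \<delta>: "0 < \<delta>" using n R by (simp add: \<delta>_def)
    define r where "r i = sqrt (real i * \<delta>)" for i
    \<comment> \<open>Squared radii are equally spaced, so rounding up the scaled squared distance
      gives the index of the annulus. The centre and the points beyond \<open>R\<close> get label 0
      and are left unconstrained.\<close>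
    define lab where "lab x = (if norm (x - y) \<le> R then nat \<lceil>(norm (x - y))\<^sup>2 / \<delta>\<rceil> else 0)" for x
    define T where "T i = (if i = 0 then UNIV else {..< z * (c + r i powr \<alpha>)})" for i
    define p where "p i = (if i = 0 then 1 else 1 - h (r i))" for i
    have lab_meas: "lab \<in> measurable borel (count_space UNIV)"
      unfolding lab_def by measurable
    have lab_iff: "lab x = i \<longleftrightarrow> x \<in> cball y (r i) - cball y (r (i - 1))" if i: "i \<in> {1..n}" for x i
    proof -
      have sq: "norm (x - y) \<le> r j \<longleftrightarrow> (norm (x - y))\<^sup>2 / \<delta> \<le> real j" for j
      proof -
        have "norm (x - y) \<le> r j \<longleftrightarrow> sqrt ((norm (x - y))\<^sup>2) \<le> sqrt (real j * \<delta>)"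
          by (simp only: r_def real_sqrt_abs abs_norm_cancel)
        also have "\<dots> \<longleftrightarrow> (norm (x - y))\<^sup>2 / \<delta> \<le> real j"
          using \<delta> by (simp only: real_sqrt_le_iff pos_divide_le_eq)
        finally show ?thesis .
      qed
      have rn: "r n = R" using n R by (simp add: r_def \<delta>_def)
      have "norm (x - y) \<le> R" if "norm (x - y) \<le> r i"
      proof -
        have "r i \<le> r n" using i \<delta> by (simp add: r_def mult_right_mono)
        then show ?thesis using that rn by simp
      qed
      moreover have "nat \<lceil>(norm (x - y))\<^sup>2 / \<delta>\<rceil> = i \<longleftrightarrow>
          (norm (x - y))\<^sup>2 / \<delta> \<le> real i \<and> \<not> (norm (x - y))\<^sup>2 / \<delta> \<le> real (i - 1)"
        using i \<delta> by (simp add: nat_eq_iff ceiling_eq_iff of_nat_diff) linarith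
      ultimately have "lab x = i \<longleftrightarrow> norm (x - y) \<le> r i \<and> \<not> norm (x - y) \<le> r (i - 1)"
        using i unfolding lab_def sq by auto
      then show ?thesis by (simp add: dist_norm norm_minus_commute)
    qed
    have lab_le: "lab x \<le> n" for x
    proof -
      have "(norm (x - y))\<^sup>2 / \<delta> \<le> n" if "norm (x - y) \<le> R"
        using that R n power_mono[OF that, of 2] by (simp add: \<delta>_def field_simps)
      then show ?thesis by (simp add: lab_def nat_le_iff ceiling_le_iff)
    qed
    have lab_set: "{x. lab x = i} = cball y (r i) - cball y (r (i - 1))" if "i \<in> {1..n}" for i
      using lab_iff[OF that] by blast
    define E where "E = {\<omega>\<in>space M. \<forall>k. enat k < N \<omega> \<longrightarrow> m k \<omega> \<in> T (lab (X k \<omega>))}"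
    have T_meas[measurable]: "T i \<in> sets borel" for i by (simp add: T_def)
    have E_meas[measurable]: "E \<in> events"
    proof -
      note lab_meas[measurable]
      \<comment> \<open>\<open>T\<close> is evaluated at a random label; quantifying over the
        countably many label values leaves only fixed Borel sets.\<close>
      have "E = {\<omega>\<in>space M. \<forall>k. enat k < N \<omega> \<longrightarrow> (\<forall>i. lab (X k \<omega>) = i \<longrightarrow> m k \<omega> \<in> T i)}"
        by (simp add: E_def)
      also have "\<dots> \<in> events" by measurable
      finally show ?thesis .
    qed
    have "prob {\<omega>\<in>space M. m k \<omega> \<in> T i} = p i" for k i
    proof (cases "i = 0")
      case False
      have "prob {\<omega>\<in>space M. g \<omega> < t} = 1 - prob {\<omega>\<in>space M. t \<le> g \<omega>}" for t
        using prob_neg[of "\<lambda>\<omega>. t \<le> g \<omega>"] by (simp add: not_le)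
      then show ?thesis using False m_prob[OF T_meas, of k i] by (simp add: T_def p_def h_def)
    qed (simp add: T_def p_def prob_space)
    then have "prob E \<le> exp (- (\<Sum>i=1..n. (1 - p i) * (LINT x:{x. lab x = i}|lborel. intens x)))"
      unfolding E_def
      by (intro prob_marked_poisson_void_le[OF ppp N X bij m NXm lab_meas lab_le])
         (auto simp: lab_set T_def)
    also have "(\<Sum>i=1..n. (1 - p i) * (LINT x:{x. lab x = i}|lborel. intens x)) =
        (\<Sum>i=1..n. h (r i) * (LINT x:cball y (r i) - cball y (r (i - 1))|lborel. intens x))"
      by (intro sum.cong refl) (simp add: p_def lab_set)
    also have "exp (- \<dots>) \<le> exp (- (a * (2 * J - R\<^sup>2 / n)))"
    proof -
      have "set_integrable lborel (cball y t) intens" for t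
        using ppp by (simp add: poisson_point_process_def)
      from annuli_sum_ge[OF this h_meas anti h01 disc a _ n] R
      show ?thesis by (simp add: J_def r_def \<delta>_def)
    qed
    finally have E: "prob E \<le> exp (- (a * (2 * J - R\<^sup>2 / n)))" .
    have cover: "{\<omega>\<in>space M. ennreal z \<le> I \<omega>} \<union> E = space M"
    proof -
      have "ennreal z \<le> I \<omega>" if \<omega>: "\<omega> \<in> space M" "\<omega> \<notin> E" for \<omega>
      proof -
        obtain k where k: "enat k < N \<omega>" "m k \<omega> \<notin> T (lab (X k \<omega>))"
          using \<omega> by (auto simp: E_def)
        define i where "i = lab (X k \<omega>)"
        have "i \<noteq> 0" using k by (auto simp: T_def i_def split: if_splits)
        then have i: "i \<in> {1..n}" using lab_le by (auto simp: i_def Suc_le_eq)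
        have mk: "z * (c + r i powr \<alpha>) \<le> m k \<omega>"
          using k \<open>i \<noteq> 0\<close> by (simp add: T_def flip: i_def)
        \<comment> \<open>A label of at least 1 puts the point strictly outside the radius
          \<open>r (i - 1) \<ge> 0\<close>, so its distance from \<open>y\<close> is positive and
          its term alone reaches \<open>z\<close>.\<close>
        have "X k \<omega> \<in> cball y (r i) - cball y (r (i - 1))" using lab_iff[OF i] i_def by blast
        moreover have "0 \<le> r (i - 1)" using \<delta> by (simp add: r_def)
        ultimately have "0 < norm (X k \<omega> - y)" "norm (X k \<omega> - y) \<le> r i"
          by (auto simp: dist_norm norm_minus_commute)
        then have "ennreal z \<le> ennreal (m k \<omega>) * path_loss c \<alpha> (norm (X k \<omega> - y))"
          using ennreal_le_mult_path_loss c \<alpha> z mk by (meson less_imp_le)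
        also have "\<dots> \<le> I \<omega>"
          using sum_le_suminf[of "\<lambda>n. if enat n < N \<omega> then ennreal (m n \<omega>) * path_loss c \<alpha> (norm (X n \<omega> - y)) else 0" "{k}"] k
          by (simp add: I[OF \<omega>(1)])
        finally show ?thesis .
      qed
      then show ?thesis by (auto simp: E_def)
    qed
    then have "1 \<le> prob {\<omega>\<in>space M. ennreal z \<le> I \<omega>} + prob E"
      using measure_Un_le[of "{\<omega>\<in>space M. ennreal z \<le> I \<omega>}" M E] by (simp add: cover prob_space)
    with E show ?thesis by linarith
  qed
  \<comment> \<open>Refining the annuli removes the error term.\<close>
  have "(\<lambda>n. exp (- (a * (2 * J - R\<^sup>2 / n)))) \<longlonglongrightarrow> exp (- (a * (2 * J - 0)))"
    by (intro tendsto_intros lim_const_over_n)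
  then have "1 - prob {\<omega>\<in>space M. ennreal z \<le> I \<omega>} \<le> exp (- (a * (2 * J - 0)))"
    by (rule LIMSEQ_le_const) (use bound in \<open>auto intro!: exI[of _ 1]\<close>)
  then show ?thesis by (simp add: J_def h_def I_def mult_ac)
qed

section \<open>Passage to the largest disc inside \<open>G\<close>\<close>

theorem theorem4:
  fixes M :: "'w measure"
    and \<Phi> :: "'w \<Rightarrow> (real ^ 2) set"
    and mark :: "'w \<Rightarrow> real ^ 2 \<Rightarrow> real"
    and g :: "'w \<Rightarrow> real"
    and F :: "real \<Rightarrow> real"
    and \<alpha> c lam z :: real
    and G :: "(real ^ 2) set"
    and y0 :: "real ^ 2"
  assumes "prob_space M"
    and "\<alpha> \<ge> 2" and "c \<ge> 0" and "lam > 0"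
    and "F \<in> borel_measurable (restrict_space borel {0..})"
    and "F \<in> {0..} \<rightarrow> {0..1}"
    and "poisson_point_process M (\<lambda>x. lam * F (norm x)) \<Phi>"
    and "g \<in> borel_measurable M"
    and "AE \<omega> in M. 0 \<le> g \<omega>"
    and "integrable M g" and "(LINT \<omega>|M. g \<omega>) = 1"
    and "iid_marks M \<Phi> mark g"
    and "open G"
    and "subharmonic_on G (\<lambda>x. lam * F (norm x))"
    and "y0 \<in> G"
    and "z > 0"
  shows "measure M {\<omega>\<in>space M. interference c \<alpha> (\<Phi> \<omega>) (mark \<omega>) y0 \<ge> ennreal z} \<ge>
    1 - exp (- (2 * pi * lam * F (norm y0) *
      (LBINT r=0..disc_radius G y0.
         r * measure M {\<omega>\<in>space M. g \<omega> \<ge> z * (c + r powr \<alpha>)})))"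
proof -
  interpret prob_space M by fact
  \<comment> \<open>Chosen so that \<open>a * t\<^sup>2\<close> is the intensity at
    \<open>y0\<close> times the area of the disc of radius \<open>t\<close>.\<close>
  define a where "a = lam * F (norm y0) * pi"
  define h where "h r = prob {\<omega>\<in>space M. g \<omega> \<ge> z * (c + r powr \<alpha>)}" for r
  define P where "P = prob {\<omega>\<in>space M. interference c \<alpha> (\<Phi> \<omega>) (mark \<omega>) y0 \<ge> ennreal z}"
  define b where "b = disc_radius G y0"
  have a: "0 \<le> a"
    using \<open>lam > 0\<close> \<open>F \<in> {0..} \<rightarrow> {0..1}\<close> by (auto simp: a_def Pi_iff intro!: mult_nonneg_nonneg)
  have bound: "1 - exp (- (2 * a * (LINT r:{0..R}|lborel. r * h r))) \<le> P"
    if R: "0 < R" "cball y0 R \<subseteq> G" for R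
    unfolding h_def P_def
  proof (rule interference_tail_ge)
    fix t assume t: "0 \<le> t" "t \<le> R"
    have "a * t\<^sup>2 = lam * F (norm y0) * measure lborel (cball y0 t)"
      using t by (simp add: content_cball a_def unit_ball_vol_2)
    also have "\<dots> \<le> (LINT x:cball y0 t|lborel. lam * F (norm x))"
      using subharmonic_on_sub_mean_value[OF \<open>subharmonic_on G _\<close>, of y0 t] t R by force
    finally show "a * t\<^sup>2 \<le> (LINT x:cball y0 t|lborel. lam * F (norm x))" .
  qed (use assms a R in auto)
  obtain t0 where "0 < t0" "cball y0 t0 \<subseteq> G"
    using \<open>open G\<close> \<open>y0 \<in> G\<close> open_contains_cball by blast
  then have "ereal t0 \<le> b" unfolding b_def disc_radius_def by (intro Sup_upper) auto
  then have b: "0 < b" using \<open>0 < t0\<close> by (meson ereal_less(2) less_le_trans)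
  have "1 - exp (- (2 * a * (LBINT r=0..b. r * h r))) \<le> P"
  \<comment> \<open>If the integrand is not integrable, its Bochner integral has the default value 0
    and the claim reads \<open>0 \<le> P\<close>.\<close>
  proof (cases "set_integrable lborel (einterval 0 b) (\<lambda>r. r * h r)")
    case True
    \<comment> \<open>Compact intervals exhaust the open one, which treats finite and infinite
      \<open>b\<close> alike. Each \<open>u i\<close> lies below the supremum \<open>b\<close>,
      hence is the radius of a disc inside \<open>G\<close>.\<close>
    obtain u l :: "nat \<Rightarrow> real" where ul: "einterval 0 b = (\<Union>i. {l i..u i})" "incseq u" "decseq l"
      "\<And>i. l i < u i" "\<And>i. 0 < ereal (l i)" "\<And>i. ereal (u i) < b"
      "(\<lambda>i. ereal (l i)) \<longlonglongrightarrow> 0" "(\<lambda>i. ereal (u i)) \<longlonglongrightarrow> b"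
      by (blast intro: einterval_Icc_approximation[OF b])
    have "1 - P \<le> exp (- (2 * a * (LINT r:{l i..u i}|lborel. r * h r)))" for i
    proof -
      obtain t where t: "u i < t" "cball y0 t \<subseteq> G"
        using ul(6)[of i] unfolding b_def disc_radius_def less_Sup_iff by auto
      have l: "0 < l i" using ul(5)[of i] by simp
      have "cball y0 (u i) \<subseteq> G" using t by (meson cball_subset_cball_iff less_imp_le order_trans subset_cball)
      moreover have "0 < u i" using l ul(4)[of i] by simp
      ultimately have *: "1 - P \<le> exp (- (2 * a * (LINT r:{0..u i}|lborel. r * h r)))"
        using bound by fastforce
      \<comment> \<open>Integrability is given on an open interval only; the point 0, where the
        integrand vanishes, is added.\<close>
      have int: "set_integrable lborel {0..u i} (\<lambda>r. r * h r)"
      proof (rule set_integrable_subset)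
        have "(\<lambda>r. indicat_real {0} r *\<^sub>R (r * h r)) = (\<lambda>_. 0)"
          by (auto simp: indicator_def fun_eq_iff)
        then have "set_integrable lborel {0} (\<lambda>r. r * h r)" by (simp add: set_integrable_def)
        then show "set_integrable lborel ({0} \<union> einterval 0 b) (\<lambda>r. r * h r)"
          by (rule set_integrable_Un[OF _ True]) auto
        show "{0..u i} \<subseteq> {0} \<union> einterval 0 b"
          using ul(6)[of i] by (auto simp: einterval_def intro: le_less_trans[of _ "ereal (u i)"])
      qed simp
      \<comment> \<open>The integrand is nonnegative, so dropping the radii below \<open>l i\<close>
        only weakens the bound.\<close>
      have "(LINT r:{l i..u i}|lborel. r * h r) \<le> (LINT r:{0..u i}|lborel. r * h r)"
        unfolding set_lebesgue_integral_def
      proof (rule integral_mono)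
        show "integrable lborel (\<lambda>r. indicator {l i..u i} r *\<^sub>R (r * h r))"
          using set_integrable_subset[OF int, of "{l i..u i}"] l by (simp add: set_integrable_def)
        show "integrable lborel (\<lambda>r. indicator {0..u i} r *\<^sub>R (r * h r))"
          using int by (simp add: set_integrable_def)
        show "indicator {l i..u i} r *\<^sub>R (r * h r) \<le> indicator {0..u i} r *\<^sub>R (r * h r)" for r
          using l by (auto simp: indicator_def h_def)
      qed
      then show ?thesis using * a
        by (elim order_trans) (simp add: mult_left_mono)
    qed
    moreover have "(\<lambda>i. exp (- (2 * a * (LINT r:{l i..u i}|lborel. r * h r)))) \<longlonglongrightarrow>
        exp (- (2 * a * (LINT r:einterval 0 b|lborel. r * h r)))"
      unfolding ul(1)
      by (intro tendsto_intros set_integral_cont_up)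
         (use True ul in \<open>auto simp: incseq_def decseq_def intro: order_trans\<close>)
    ultimately have "1 - P \<le> exp (- (2 * a * (LINT r:einterval 0 b|lborel. r * h r)))"
      by (intro LIMSEQ_le_const) auto
    then show ?thesis using less_imp_le[OF b] by (simp add: interval_lebesgue_integral_def)
  next
    case False
    then have "(LBINT r=0..b. r * h r) = 0"
      using less_imp_le[OF b] by (simp add: interval_lebesgue_integral_def set_lebesgue_integral_def
          set_integrable_def not_integrable_integral_eq)
    then show ?thesis by (simp add: P_def)
  qed
  then show ?thesis by (simp add: a_def b_def h_def P_def mult_ac)
qed

end
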